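(* Let $E$ be a complex Banach lattice and let $A: E \supseteq D(A) \to E$ be a densely defined, closed, real linear operator. Let $u \in E_+$ and let $\varphi \in E'_+$ be strictly positive. Assume: (Domination) there are integers $m_1, m_2 \ge 0$ such that $D(A^{m_1}) \subseteq E_u$ and $D((A')^{m_2}) \subseteq (E')_\varphi$; (Spectral) there is $\lambda_0 \in \mathbb{R}$ which is a geometrically simple eigenvalue of $A$ and an eigenvalue of $A'$, such that $\ker(\lambda_0 - A)$ is spanned by a vector $v$ with $v \succeq u$, and $\ker(\lambda_0 - A')$ contains an element $\psi$ with $\psi \succeq \varphi$. Suppose there is $\mu_1 > \lambda_0$ in $\rho(A)$ with $R(\mu_1,A) \succeq -u\otimes\varphi$. Then the following are equivalent: (i) there is $\varepsilon>0$ such that $(\lambda_0-\varepsilon,\lambda_0)\subseteq\rho(A)$ and $R(\mu,A)\preceq -u\otimes\varphi$ for all $\mu\in(\lambda_0-\varepsilon,\lambda_0)$; (ii) there exists $\mu_0<\lambda_0$ in $\rho(A)$ with $R(\mu_0,A)\le 0$ (i.e. $-R(\mu_0,A)$ is a positive operator); (iii) $R(\mu_1,A)\preceq u\otimes\varphi$.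
   Context: $E_{\mathbb{R}}$ denotes the real part of $E$; $E'$ is the dual Banach lattice. A linear operator $A$ is real if $D(A) = (D(A)\cap E_{\mathbb{R}}) + i(D(A)\cap E_{\mathbb{R}})$ and $A$ maps $D(A)\cap E_{\mathbb{R}}$ into $E_{\mathbb{R}}$. $R(\mu,A) = (\mu - A)^{-1}$. For real vectors, $v \succeq u$ means $v \ge cu$ for some $c>0$. For bounded real operators, $T\succeq S$ (equivalently $S\preceq T$) means $T - cS$ is positive for some $c>0$. $u\otimes\varphi$ is the operator $f\mapsto\langle\varphi,f\rangle u$. $\varphi$ strictly positive: $\langle\varphi,f\rangle>0$ for all $0\ne f\in E_+$. $E_u = \{x : |x|\le cu \text{ for some } c\ge0\}$; $(E')_\varphi = \{x'\in E' : |x'|\le c\varphi \text{ for some } c\ge 0\}$. Geometrically simple: one-dimensional eigenspace. *)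

theory Defs
  imports "HOL-Analysis.Analysis"
begin

class banach_lattice = banach + ordered_real_vector + lattice +
  assumes lattice_norm: "sup x (- x) \<le> sup y (- y) \<Longrightarrow> norm x \<le> norm y"

text \<open>An element (x, y) :: 'r \<times> 'r stands for x + i y.  The topology is the
  product topology (equivalent to the topology of the complexified lattice norm).\<close>

type_synonym 'r cpx = "'r \<times> 'r"

definition cmul :: "complex \<Rightarrow> 'r::real_vector cpx \<Rightarrow> 'r cpx" where
  "cmul c z = (Re c *\<^sub>R fst z - Im c *\<^sub>R snd z, Re c *\<^sub>R snd z + Im c *\<^sub>R fst z)"

definition ER :: "'r::real_vector cpx set" where
  "ER = {z. snd z = 0}"

definition leE :: "'r::banach_lattice cpx \<Rightarrow> 'r cpx \<Rightarrow> bool" where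
  "leE z w \<longleftrightarrow> z \<in> ER \<and> w \<in> ER \<and> fst z \<le> fst w"

definition Epos :: "'r::banach_lattice cpx set" where
  "Epos = {z. leE 0 z}"

definition latmod :: "'r::banach_lattice \<Rightarrow> 'r \<Rightarrow> 'r" where
  "latmod x y = (THE m. (\<forall>t. cos t *\<^sub>R x + sin t *\<^sub>R y \<le> m) \<and>
      (\<forall>m'. (\<forall>t. cos t *\<^sub>R x + sin t *\<^sub>R y \<le> m') \<longrightarrow> m \<le> m'))"

definition modE :: "'r::banach_lattice cpx \<Rightarrow> 'r cpx" where
  "modE z = (latmod (fst z) (snd z), 0)"

definition ideal_E :: "'r::banach_lattice cpx \<Rightarrow> 'r cpx set" where
  "ideal_E u = {x. \<exists>c\<ge>0. leE (modE x) (c *\<^sub>R u)}"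

definition succE :: "'r::banach_lattice cpx \<Rightarrow> 'r cpx \<Rightarrow> bool" where
  "succE v u \<longleftrightarrow> (\<exists>c>0. leE (c *\<^sub>R u) v)"

definition dualE :: "('r::banach_lattice cpx \<Rightarrow> complex) set" where
  "dualE = {f. bounded_linear f \<and> (\<forall>z. f (cmul \<i> z) = \<i> * f z)}"

definition dual_pos :: "('r::banach_lattice cpx \<Rightarrow> complex) set" where
  "dual_pos = {f \<in> dualE. \<forall>z\<in>Epos. Im (f z) = 0 \<and> 0 \<le> Re (f z)}"

definition strictly_positive :: "('r::banach_lattice cpx \<Rightarrow> complex) \<Rightarrow> bool" where
  "strictly_positive \<phi> \<longleftrightarrow> \<phi> \<in> dual_pos \<and> (\<forall>f\<in>Epos. f \<noteq> 0 \<longrightarrow> 0 < Re (\<phi> f))"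

definition succD :: "('r::banach_lattice cpx \<Rightarrow> complex) \<Rightarrow> ('r cpx \<Rightarrow> complex) \<Rightarrow> bool" where
  "succD \<psi> \<phi> \<longleftrightarrow> (\<exists>c>0. (\<lambda>f. \<psi> f - of_real c * \<phi> f) \<in> dual_pos)"

text \<open>principal ideal (E')_phi = {x' : |x'| \<le> c phi}; for f \<ge> 0 the modulus of x'
  is |x'|(f) = sup {|x'(g)| : |g| \<le> f}\<close>
definition ideal_D :: "('r::banach_lattice cpx \<Rightarrow> complex) \<Rightarrow> ('r cpx \<Rightarrow> complex) set" where
  "ideal_D \<phi> = {x' \<in> dualE. \<exists>c\<ge>0. \<forall>f\<in>Epos. \<forall>g. leE (modE g) f \<longrightarrow>
       cmod (x' g) \<le> c * Re (\<phi> f)}"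

definition clinear_op :: "'r::banach_lattice cpx set \<Rightarrow> ('r cpx \<Rightarrow> 'r cpx) \<Rightarrow> bool" where
  "clinear_op D A \<longleftrightarrow> 0 \<in> D \<and> (\<forall>x\<in>D. \<forall>y\<in>D. x + y \<in> D \<and> A (x + y) = A x + A y) \<and>
     (\<forall>c. \<forall>x\<in>D. cmul c x \<in> D \<and> A (cmul c x) = cmul c (A x))"

definition densely_defined :: "'r::banach_lattice cpx set \<Rightarrow> bool" where
  "densely_defined D \<longleftrightarrow> closure D = UNIV"

definition closed_op :: "'r::banach_lattice cpx set \<Rightarrow> ('r cpx \<Rightarrow> 'r cpx) \<Rightarrow> bool" where
  "closed_op D A \<longleftrightarrow> closed {(x, A x) | x. x \<in> D}"

definition real_op :: "'r::banach_lattice cpx set \<Rightarrow> ('r cpx \<Rightarrow> 'r cpx) \<Rightarrow> bool" where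
  "real_op D A \<longleftrightarrow> D = {x + cmul \<i> y | x y. x \<in> D \<inter> ER \<and> y \<in> D \<inter> ER} \<and>
     (\<forall>x \<in> D \<inter> ER. A x \<in> ER)"

fun pow_dom :: "'a set \<Rightarrow> 'a set \<Rightarrow> ('a \<Rightarrow> 'a) \<Rightarrow> nat \<Rightarrow> 'a set" where
  "pow_dom X D A 0 = X"
| "pow_dom X D A (Suc m) = {x \<in> D. A x \<in> pow_dom X D A m}"

definition adj_dom :: "'r::banach_lattice cpx set \<Rightarrow> ('r cpx \<Rightarrow> 'r cpx) \<Rightarrow> ('r cpx \<Rightarrow> complex) set" where
  "adj_dom D A = {\<phi> \<in> dualE. \<exists>\<psi> \<in> dualE. \<forall>f\<in>D. \<phi> (A f) = \<psi> f}"

definition adj :: "'r::banach_lattice cpx set \<Rightarrow> ('r cpx \<Rightarrow> 'r cpx) \<Rightarrow> ('r cpx \<Rightarrow> complex) \<Rightarrow> ('r cpx \<Rightarrow> complex)" where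
  "adj D A \<phi> = (THE \<psi>. \<psi> \<in> dualE \<and> (\<forall>f\<in>D. \<phi> (A f) = \<psi> f))"

definition resolvent :: "'r::banach_lattice cpx set \<Rightarrow> ('r cpx \<Rightarrow> 'r cpx) \<Rightarrow> complex \<Rightarrow> 'r cpx \<Rightarrow> 'r cpx" where
  "resolvent D A \<mu> = (\<lambda>y. THE x. x \<in> D \<and> cmul \<mu> x - A x = y)"

definition resolvent_set :: "'r::banach_lattice cpx set \<Rightarrow> ('r cpx \<Rightarrow> 'r cpx) \<Rightarrow> complex set" where
  "resolvent_set D A = {\<mu>. (\<forall>y. \<exists>!x. x \<in> D \<and> cmul \<mu> x - A x = y) \<and>
      bounded_linear (resolvent D A \<mu>)}"

definition pos_op :: "('r::banach_lattice cpx \<Rightarrow> 'r cpx) \<Rightarrow> bool" where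
  "pos_op T \<longleftrightarrow> (\<forall>z\<in>Epos. T z \<in> Epos)"

definition succOp :: "('r::banach_lattice cpx \<Rightarrow> 'r cpx) \<Rightarrow> ('r cpx \<Rightarrow> 'r cpx) \<Rightarrow> bool" where
  "succOp T S \<longleftrightarrow> (\<exists>c>0. pos_op (\<lambda>z. T z - c *\<^sub>R S z))"

definition rank1 :: "'r::banach_lattice cpx \<Rightarrow> ('r cpx \<Rightarrow> complex) \<Rightarrow> 'r cpx \<Rightarrow> 'r cpx" where
  "rank1 u \<phi> = (\<lambda>f. cmul (\<phi> f) u)"

end

theory Submission
  imports Defs
begin

text \<open>
  Since A is real, everything reduces to the real Banach lattice.  Domination is uniform by
  Baire's theorem: if R0 is a negative resolvent, then R0^m1 maps the unit ball into a
  multiple of [-u, u], and the norm of R0^m2 f is at most a multiple of \<phi>(|f|) (uniform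
  boundedness on the dual and Hahn--Banach).  Iterating the resolvent identity m1 + m2 times
  then bounds R(\<mu>1) from above, which is (ii) implies (iii).

  For (iii) implies (i) one has |R(\<mu>1) f| \<le> C \<phi>(|f|) u, so that R(\<mu>1) behaves like an
  integral operator with bounded kernel.  The ideal generated by u carries a Hilbert norm
  lying between \<phi>(|f|) and the gauge norm of u, with respect to which such operators are
  Hilbert--Schmidt; hence they satisfy the Fredholm alternative.  Applied to
  (\<mu>1 - lam0) R(\<mu>1) minus the spectral projection onto v, it shows that lam0 is a simple pole
  with residue v \<otimes> \<psi> / \<psi>(v), and this term dominates the resolvent to the left of lam0.
\<close>

subsection \<open>Real Banach lattices\<close>

text \<open>Neither compactness of the resolvent nor isolation of \<open>lam0\<close> in the
  spectrum is assumed, and E is neither order complete nor given as a function space. That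
  \<open>lam0\<close> is a pole has to be extracted from the two-sided bound by u \<otimes> \<phi>.
  Over a measure space such a bound makes the operator factor through L^1 -> L^infinity, hence
  Hilbert--Schmidt on the L^2 in between. That Hilbert space is rebuilt from the order and \<phi>;
  since the ideal need not be complete for it, series are summed in the gauge norm, to which one
  application of the operator leads.

  The domination hypotheses enter twice. Besides bounding R0^m1 and R0^m2 they apply to the
  eigenvectors, which lie in all powers of the domains: v is comparable with u and \<psi> with
  \<phi> from both sides, so that the residue is comparable with u \<otimes> \<phi>. Since \<psi>(v)
  > 0, geometric simplicity already makes the eigenvalue algebraically simple.\<close>

definition lmod :: "'a::banach_lattice \<Rightarrow> 'a" where
  "lmod x = sup x (- x)"

lemma lmod_le_iff: "lmod x \<le> y \<longleftrightarrow> x \<le> y \<and> - x \<le> y"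
  by (simp add: lmod_def)

lemma lmod_upper: "x \<le> lmod x" "- x \<le> lmod x"
  by (simp_all add: lmod_def)

lemma lmod_nonneg [simp]: "0 \<le> lmod x"
proof -
  have "x + - x \<le> lmod x + lmod x"
    by (intro add_mono lmod_upper)
  then have "(1/2) *\<^sub>R 0 \<le> (1/2) *\<^sub>R (2 *\<^sub>R lmod x)"
    by (intro scaleR_left_mono) (auto simp: scaleR_2)
  then show ?thesis by simp
qed

lemma lmod_of_nonneg [simp]: "0 \<le> x \<Longrightarrow> lmod x = x"
  by (rule antisym) (auto simp: lmod_le_iff lmod_upper intro: order_trans[of _ 0])

lemma lmod_minus [simp]: "lmod (- x) = lmod x"
  by (simp add: lmod_def sup_commute)

lemma lmod_triangle: "lmod (x + y) \<le> lmod x + lmod y"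
  using add_mono[OF lmod_upper(1)[of x] lmod_upper(1)[of y]]
    add_mono[OF lmod_upper(2)[of x] lmod_upper(2)[of y]]
  by (simp add: lmod_le_iff)

lemma lmod_triangle_minus: "lmod (x - y) \<le> lmod x + lmod y"
  using lmod_triangle[of x "- y"] by simp

lemma lmod_scaleR_le: "lmod (a *\<^sub>R x) \<le> \<bar>a\<bar> *\<^sub>R lmod x"
proof (cases "0 \<le> a")
  case True
  then show ?thesis
    using scaleR_left_mono[OF lmod_upper(1)[of x], of a] scaleR_left_mono[OF lmod_upper(2)[of x], of a]
    by (simp add: lmod_le_iff)
next
  case False
  then show ?thesis
    using scaleR_left_mono[OF lmod_upper(1)[of x], of "-a"] scaleR_left_mono[OF lmod_upper(2)[of x], of "-a"]
    by (simp add: lmod_le_iff)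
qed

lemma lmod_eq_0_iff [simp]: "lmod x = 0 \<longleftrightarrow> x = 0"
  using lmod_upper[of x] by (auto intro: antisym)

lemma norm_le_of_lmod_le:
  fixes x y :: "'a::banach_lattice"
  assumes "lmod x \<le> y" shows "norm x \<le> norm y"
proof -
  have "0 \<le> y" using assms lmod_nonneg order_trans by blast
  then have "lmod y = y" by simp
  then show ?thesis
    using assms by (intro lattice_norm) (simp flip: lmod_def)
qed

lemma scaleR_le_scaleR:
  fixes u :: "'a::ordered_real_vector"
  assumes "x \<le> a *\<^sub>R u" "a \<le> b" "0 \<le> u" shows "x \<le> b *\<^sub>R u"
  using assms scaleR_right_mono order_trans by blast

lemma nonneg_parts:
  fixes x :: "'a::banach_lattice"
  obtains p n where "0 \<le> p" "0 \<le> n" "x = p - n" "lmod x = p + n"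
proof
  have "0 \<le> lmod x + x" "0 \<le> lmod x - x"
    using lmod_upper[of x] add_left_mono[OF lmod_upper(2)[of x], of x] by (simp_all add: add.commute)
  then show "0 \<le> (1/2) *\<^sub>R (lmod x + x)" "0 \<le> (1/2) *\<^sub>R (lmod x - x)"
    by (simp_all add: scaleR_nonneg_nonneg)
  show "x = (1/2) *\<^sub>R (lmod x + x) - (1/2) *\<^sub>R (lmod x - x)"
    by (simp add: algebra_simps flip: scaleR_left_distrib)
  show "lmod x = (1/2) *\<^sub>R (lmod x + x) + (1/2) *\<^sub>R (lmod x - x)"
    by (simp add: algebra_simps flip: scaleR_left_distrib)
qed

text \<open>The negative part of the limit is dominated by the modulus of \<open>X n - l\<close>, so
  its norm is 0. All later passages of inequalities to norm limits rest on this.\<close>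

lemma closed_nonneg: "closed {x::'a::banach_lattice. 0 \<le> x}"
  unfolding closed_sequential_limits
proof safe
  fix X :: "nat \<Rightarrow> 'a" and l
  assume X: "\<forall>n. X n \<in> {x. 0 \<le> x}" and lim: "X \<longlonglongrightarrow> l"
  let ?n = "sup (- l) 0"
  have "norm ?n \<le> norm (X n - l)" for n
  proof (rule norm_le_of_lmod_le[THEN order_trans])
    have "- l \<le> X n - l" using X by simp
    then have "- l \<le> lmod (X n - l)" using lmod_upper(1) order_trans by blast
    then have "?n \<le> lmod (X n - l)" by simp
    then show "lmod ?n \<le> lmod (X n - l)" by simp
    have "lmod (lmod (X n - l)) \<le> lmod (X n - l)" by simp
    then show "norm (lmod (X n - l)) \<le> norm (X n - l)"
      by (intro lattice_norm) (simp only: flip: lmod_def)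
  qed
  moreover have "(\<lambda>n. norm (X n - l)) \<longlonglongrightarrow> 0"
    using lim by (simp add: LIM_zero_iff tendsto_norm_zero_iff)
  ultimately have "norm ?n \<le> 0"
    by (intro LIMSEQ_le_const) auto
  then have "sup (- l) 0 = 0" by simp
  then show "0 \<le> l" by (metis neg_le_0_iff_le sup.cobounded1)
qed

lemma closed_le_const: "closed {x::'a::banach_lattice. x \<le> w}"
proof -
  have "{x. x \<le> w} = (\<lambda>x. w - x) -` {x. 0 \<le> x}" by auto
  then show ?thesis
    by (simp only:) (intro closed_vimage closed_nonneg continuous_intros)
qed

lemma closed_lmod_le: "closed {x::'a::banach_lattice. lmod x \<le> w}"
proof -
  have "{x. lmod x \<le> w} = {x. x \<le> w} \<inter> (\<lambda>x. - x) -` {x. x \<le> w}"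
    by (auto simp: lmod_le_iff)
  then show ?thesis
    by (simp only:) (intro closed_Int closed_vimage closed_le_const continuous_intros)
qed

subsection \<open>Three principles of functional analysis\<close>

text \<open>The condition \<open>mid\<close> combines symmetry and midpoint convexity: half the
  difference of a + x and a - x is x, so a ball around an interior point a moves to one around 0. It
  is applied to closures of images of balls, to vectors with a common order bound and to functionals
  with a common bound.\<close>

lemma Baire_symmetric_convex:
  fixes C :: "nat \<Rightarrow> 'a::banach set"
  assumes cl: "\<And>n. closed (C n)" and UN: "(\<Union>n. C n) = UNIV"
    and mid: "\<And>n x y. x \<in> C n \<Longrightarrow> y \<in> C n \<Longrightarrow> (1/2) *\<^sub>R (x - y) \<in> C n"
  obtains n \<delta> where "\<delta> > 0" "\<And>x. norm x < \<delta> \<Longrightarrow> x \<in> C n"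
proof -
  have "\<exists>n. interior (C n) \<noteq> {}"
  proof (rule ccontr)
    assume "\<not> ?thesis"
    then have "euclidean interior_of \<Union>(range C) = {}"
      by (intro Baire_category_alt) (auto simp: completely_metrizable_space_euclidean cl)
    then show False using UN by simp
  qed
  then obtain n a where "a \<in> interior (C n)" by blast
  then obtain r where r: "r > 0" "ball a r \<subseteq> C n"
    by (meson mem_interior)
  have "x \<in> C n" if "norm x < r" for x
  proof -
    have "a + x \<in> C n" "a - x \<in> C n"
      using that r(2) by (auto simp: subset_iff dist_norm)
    from mid[OF this] show ?thesis by (simp flip: scaleR_2)
  qed
  with r(1) show ?thesis using that by blast
qed

text \<open>Open mapping theorem for a bijection. Baire only gives density of the image of a ball in
  a ball; approximate preimages with halved error are summed to an exact one.\<close>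

lemma bounded_linear_inv:
  fixes f :: "'a::banach \<Rightarrow> 'b::banach"
  assumes f: "bounded_linear f" and bij: "bij f"
  shows "bounded_linear (inv f)"
proof -
  interpret f: bounded_linear f by fact
  let ?C = "\<lambda>n::nat. closure (f ` cball 0 (real n))"
  obtain n \<delta> where \<delta>: "\<delta> > 0" and n: "\<And>y. norm y < \<delta> \<Longrightarrow> y \<in> ?C n"
  proof (rule Baire_symmetric_convex[of ?C])
    show "(\<Union>n. ?C n) = UNIV"
    proof safe
      fix y
      obtain x where "y = f x" using bij by (meson bij_pointE)
      moreover obtain n where "norm x \<le> real n" using real_arch_simple by blast
      ultimately have "y \<in> f ` cball 0 (real n)" by auto
      then have "y \<in> ?C n" by (rule closure_subset[THEN subsetD])
      then show "y \<in> (\<Union>n. ?C n)" by blast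
    qed simp
    show "(1/2) *\<^sub>R (x - y) \<in> ?C n" if x: "x \<in> ?C n" and y: "y \<in> ?C n" for x y n
    proof -
      obtain X Y where X: "\<forall>k. X k \<in> f ` cball 0 (real n)" "X \<longlonglongrightarrow> x"
        and Y: "\<forall>k. Y k \<in> f ` cball 0 (real n)" "Y \<longlonglongrightarrow> y"
        using x y unfolding closure_sequential by blast
      have "(1/2) *\<^sub>R (X k - Y k) \<in> f ` cball 0 (real n)" for k
      proof -
        obtain a b where ab: "X k = f a" "Y k = f b" "norm a \<le> n" "norm b \<le> n"
          using X(1)[rule_format, of k] Y(1)[rule_format, of k] by auto
        have "norm ((1/2) *\<^sub>R (a - b)) \<le> n"
          using norm_triangle_ineq4[of a b] ab by simp
        moreover have "(1/2) *\<^sub>R (X k - Y k) = f ((1/2) *\<^sub>R (a - b))"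
          using ab by (simp add: f.scaleR f.diff)
        ultimately show ?thesis by (metis imageI mem_cball_0)
      qed
      moreover have "(\<lambda>k. (1/2) *\<^sub>R (X k - Y k)) \<longlonglongrightarrow> (1/2) *\<^sub>R (x - y)"
        by (intro tendsto_intros X Y)
      ultimately show ?thesis
        unfolding closure_sequential by (intro exI[of _ "\<lambda>k. (1/2) *\<^sub>R (X k - Y k)"]) blast
    qed
  qed auto
  \<comment> \<open>Scaling y to norm \<delta>/2 and approximating with relative error 1/2 costs the
    factor 2n/\<delta>; the geometric series of corrections later doubles it.\<close>
  have step: "\<exists>x. norm x \<le> 2 * n / \<delta> * norm y \<and> norm (y - f x) \<le> norm y / 2" for y
  proof (cases "y = 0")
    case True then show ?thesis by (auto intro!: exI[of _ 0])
  next
    case False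
    define t where "t = \<delta> / (2 * norm y)"
    have t: "t > 0" using \<delta> False by (simp add: t_def)
    have "norm (t *\<^sub>R y) < \<delta>" using \<delta> False by (simp add: t_def)
    then have "t *\<^sub>R y \<in> ?C n" by (rule n)
    then obtain x where x: "norm x \<le> n" "norm (f x - t *\<^sub>R y) < t * (norm y / 2)"
      using t False by (force simp: closure_approachable dist_norm dest: spec[of _ "t * (norm y / 2)"])
    have "y - f ((1/t) *\<^sub>R x) = - ((1/t) *\<^sub>R (f x - t *\<^sub>R y))"
      using t by (simp add: f.scaleR algebra_simps)
    then have "norm (y - f ((1/t) *\<^sub>R x)) = (1/t) * norm (f x - t *\<^sub>R y)"
      using t by simp
    also have "\<dots> \<le> norm y / 2"
      using x t by (simp add: field_simps)
    finally have 1: "norm (y - f ((1/t) *\<^sub>R x)) \<le> norm y / 2" .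
    have "norm ((1/t) *\<^sub>R x) \<le> (1/t) * n"
      using x t by (simp add: divide_right_mono)
    also have "\<dots> = 2 * n / \<delta> * norm y" by (simp add: t_def)
    finally show ?thesis using 1 by blast
  qed
  define g where "g y = (SOME x. norm x \<le> 2 * n / \<delta> * norm y \<and> norm (y - f x) \<le> norm y / 2)" for y
  have g: "norm (g y) \<le> 2 * n / \<delta> * norm y" "norm (y - f (g y)) \<le> norm y / 2" for y
    using someI_ex[OF step[of y]] by (simp_all add: g_def)
  have bound: "norm (inv f y) \<le> norm y * (4 * n / \<delta>)" for y
  proof -
    \<comment> \<open>\<open>Y k\<close> is the residual after k corrections; the images of the
      corrections telescope to \<open>y - Y m\<close>.\<close>
    define Y where "Y k = ((\<lambda>y. y - f (g y)) ^^ k) y" for k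
    have Y0: "Y 0 = y" and YS: "Y (Suc k) = Y k - f (g (Y k))" for k
      by (simp_all add: Y_def)
    have Yn: "norm (Y k) \<le> norm y * (1/2) ^ k" for k
    proof (induction k)
      case (Suc k) then show ?case using g(2)[of "Y k"] by (simp add: YS)
    qed (simp add: Y0)
    have gn: "norm (g (Y k)) \<le> (2 * n / \<delta> * norm y) * (1/2) ^ k" for k
      using g(1)[of "Y k"] mult_left_mono[OF Yn[of k], of "2 * n / \<delta>"] \<delta> by (simp add: mult.assoc)
    have sums: "(\<lambda>k. (2 * n / \<delta> * norm y) * (1/2) ^ k) sums ((2 * n / \<delta> * norm y) * 2)"
      using geometric_sums[of "1/2::real"] by (intro sums_mult) simp
    have sg: "summable (\<lambda>k. g (Y k))"
      using gn by (intro summable_comparison_test'[OF sums_summable[OF sums], of 0])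
    have "(\<lambda>m. \<Sum>k<m. f (g (Y k))) = (\<lambda>m. y - Y m)"
    proof
      fix m show "(\<Sum>k<m. f (g (Y k))) = y - Y m"
        by (induction m) (auto simp: Y0 YS)
    qed
    moreover have "Y \<longlonglongrightarrow> 0"
    proof (rule Lim_null_comparison)
      show "(\<lambda>k. norm y * (1/2) ^ k) \<longlonglongrightarrow> 0"
        by (intro tendsto_mult_right_zero LIMSEQ_realpow_zero) auto
    qed (use Yn in auto)
    ultimately have "(\<lambda>k. f (g (Y k))) sums (y - 0)"
      unfolding sums_def by (metis tendsto_diff[OF tendsto_const])
    moreover have "(\<lambda>k. f (g (Y k))) sums f (\<Sum>k. g (Y k))"
      using f.sums[OF summable_sums[OF sg]] .
    ultimately have "f (\<Sum>k. g (Y k)) = y" using sums_unique2 by force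
    then have "inv f y = (\<Sum>k. g (Y k))"
      using bij by (simp add: bij_is_inj inv_f_eq)
    moreover have "norm (\<Sum>k. g (Y k)) \<le> (\<Sum>k. (2 * n / \<delta> * norm y) * (1/2) ^ k)"
      by (rule norm_suminf_le[OF gn sums_summable[OF sums]])
    ultimately show ?thesis using sums_unique[OF sums] by (simp add: field_simps)
  qed
  have "linear (inv f)"
  proof
    have ff: "f (inv f y) = y" for y using bij by (simp add: bij_is_surj surj_f_inv_f)
    have inj: "x = y" if "f x = f y" for x y using bij that by (simp add: bij_is_inj inj_eq)
    show "inv f (x + y) = inv f x + inv f y" for x y by (rule inj) (simp add: ff f.add)
    show "inv f (c *\<^sub>R x) = c *\<^sub>R inv f x" for c x by (rule inj) (simp add: ff f.scaleR)
  qed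
  then show ?thesis
    by (intro bounded_linear_intro[where K="4 * n / \<delta>"] bound) (simp_all add: linear_add linear_scale)
qed

section \<open>Hahn--Banach by minimal sublinear functionals\<close>

definition sublinear :: "('a::real_vector \<Rightarrow> real) \<Rightarrow> bool" where
  "sublinear p \<longleftrightarrow> (\<forall>x y. p (x + y) \<le> p x + p y) \<and> (\<forall>t x. t > 0 \<longrightarrow> p (t *\<^sub>R x) = t * p x)"

lemma sublinear_zero: "sublinear p \<Longrightarrow> p 0 = 0"
  unfolding sublinear_def by (metis scaleR_zero_right mult_cancel_right2 one_neq_zero zero_less_numeral numeral_eq_one_iff semiring_norm(85))

text \<open>The infimum over t >= 0 of p(x + t a) - t p(a) lowers p until it is odd along a. Hence a
  p with no strictly smaller sublinear functional below it satisfies p(-a) <= -p(a), which is the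
  heart of the minimality argument.\<close>

lemma sublinear_reduce:
  fixes p :: "'a::real_vector \<Rightarrow> real"
  assumes p: "sublinear p"
  obtains q where "sublinear q" "\<And>x. q x \<le> p x" "q (- a) \<le> - p a"
proof
  have add: "p (x + y) \<le> p x + p y" and scale: "t > 0 \<Longrightarrow> p (t *\<^sub>R x) = t * p x" for x y t
    using p by (auto simp: sublinear_def)
  have scale0: "t \<ge> 0 \<Longrightarrow> p (t *\<^sub>R x) = t * p x" for x t
    using scale[of t x] sublinear_zero[OF p] by (cases "t = 0") auto
  define S where "S x = (\<lambda>t. p (x + t *\<^sub>R a) - t * p a) ` {0..}" for x
  define q where "q x = Inf (S x)" for x
  \<comment> \<open>Subadditivity gives a lower bound independent of t, so the infimum is
    finite.\<close>
  have lower: "- p (- x) \<le> s" if mem: "s \<in> S x" for s x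
  proof -
    obtain t where t: "t \<ge> 0" "s = p (x + t *\<^sub>R a) - t * p a"
      using mem unfolding S_def by auto
    have "t * p a = p ((x + t *\<^sub>R a) + (- x))"
      using scale0[OF t(1)] by simp
    also have "\<dots> \<le> p (x + t *\<^sub>R a) + p (- x)" by (rule add)
    finally show ?thesis using t by simp
  qed
  have bdd: "bdd_below (S x)" for x
    using lower by (meson bdd_belowI)
  have ne: "S x \<noteq> {}" for x by (auto simp: S_def)
  have qle: "q x \<le> p (x + t *\<^sub>R a) - t * p a" if "t \<ge> 0" for x t
    unfolding q_def using that by (intro cInf_lower bdd) (auto simp: S_def)
  show "q x \<le> p x" for x using qle[of 0 x] by simp
  show "q (- a) \<le> - p a" using qle[of 1 "- a"] sublinear_zero[OF p] by simp
  have qadd: "q (x + y) \<le> q x + q y" for x y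
  proof -
    have "q (x + y) - s \<le> r" if mem: "s \<in> S x" "r \<in> S y" for s r
    proof -
      obtain t t' where t: "t \<ge> 0" "s = p (x + t *\<^sub>R a) - t * p a"
        and t': "t' \<ge> 0" "r = p (y + t' *\<^sub>R a) - t' * p a"
        using mem unfolding S_def by auto
      have "q (x + y) \<le> p ((x + y) + (t + t') *\<^sub>R a) - (t + t') * p a"
        using t t' by (intro qle) simp
      also have "(x + y) + (t + t') *\<^sub>R a = (x + t *\<^sub>R a) + (y + t' *\<^sub>R a)"
        by (simp add: algebra_simps)
      also have "p \<dots> \<le> p (x + t *\<^sub>R a) + p (y + t' *\<^sub>R a)" by (rule add)
      finally show ?thesis using t t' by (simp add: algebra_simps)
    qed
    then have "q (x + y) - s \<le> q y" if "s \<in> S x" for s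
      unfolding q_def[of y] using that ne by (intro cInf_greatest)
    then have "q (x + y) - q y \<le> s" if "s \<in> S x" for s using that by fastforce
    then have "q (x + y) - q y \<le> q x"
      unfolding q_def[of x] using ne by (intro cInf_greatest)
    then show ?thesis by simp
  qed
  have qs: "q (c *\<^sub>R x) \<le> c * q x" if c: "c > 0" for c x
  proof -
    have "q (c *\<^sub>R x) / c \<le> s" if mem: "s \<in> S x" for s
    proof -
      obtain t where t: "t \<ge> 0" "s = p (x + t *\<^sub>R a) - t * p a"
        using mem unfolding S_def by auto
      have "q (c *\<^sub>R x) \<le> p (c *\<^sub>R x + (c * t) *\<^sub>R a) - (c * t) * p a"
        using t c by (intro qle) simp
      also have "c *\<^sub>R x + (c * t) *\<^sub>R a = c *\<^sub>R (x + t *\<^sub>R a)" by (simp add: algebra_simps)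
      also have "p \<dots> = c * p (x + t *\<^sub>R a)" using c by (rule scale)
      finally have "q (c *\<^sub>R x) \<le> c * s" by (simp add: t(2) algebra_simps)
      then show ?thesis using c by (simp add: field_simps)
    qed
    then have "q (c *\<^sub>R x) / c \<le> q x"
      unfolding q_def[of x] using ne by (intro cInf_greatest)
    then show ?thesis using c by (simp add: field_simps)
  qed
  have "q (c *\<^sub>R x) = c * q x" if c: "c > 0" for c x
    using qs[OF c, of x] qs[of "1/c" "c *\<^sub>R x"] c by (simp add: field_simps)
  with qadd show "sublinear q" by (simp add: sublinear_def)
qed

text \<open>Hahn--Banach: a minimal sublinear functional below the norm is linear.\<close>
lemma norming_functional:
  fixes a :: "'a::real_normed_vector"
  obtains f :: "'a \<Rightarrow> real" where "bounded_linear f" "\<And>x. \<bar>f x\<bar> \<le> norm x" "f a = norm a"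
proof -
  have "sublinear (norm :: 'a \<Rightarrow> real)"
    by (simp add: sublinear_def norm_triangle_ineq)
  \<comment> \<open>The bound at - a pins the final value: an odd functional below \<open>p0\<close>
    is at least \<open>norm a\<close> at a.\<close>
  then obtain p0 :: "'a \<Rightarrow> real" where p0: "sublinear p0" "\<And>x. p0 x \<le> norm x" "p0 (- a) \<le> - norm a"
    using sublinear_reduce[of norm a] by blast
  define F where "F = {p. sublinear p \<and> (\<forall>x. p x \<le> p0 x)}"
  \<comment> \<open>\<open>P\<close> is the reversed pointwise order, so the maximal element
    supplied by Zorn is a pointwise minimal functional.\<close>
  define P where "P p q \<longleftrightarrow> (\<forall>x. q x \<le> p x)" for p q :: "'a \<Rightarrow> real"
  have lower: "- norm x \<le> p x" if "p \<in> F" for p x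
  proof -
    have "0 \<le> p x + p (- x)"
      using that sublinear_zero[of p] unfolding F_def sublinear_def
      by simp (metis add.right_inverse)
    moreover have "p (- x) \<le> norm x"
      using that p0(2)[of "- x"] order_trans by (fastforce simp: F_def)
    ultimately show ?thesis by linarith
  qed
  have "\<exists>m \<in> F. \<forall>p \<in> F. P m p \<longrightarrow> p = m"
  proof (rule predicate_Zorn)
    show "partial_order_on F (relation_of P F)"
      unfolding partial_order_on_def preorder_on_def refl_on_def trans_def antisym_def relation_of_def P_def
      by (auto intro: order_trans) (meson antisym ext)?
    fix C assume C: "C \<in> Chains (relation_of P F)"
    have CF: "C \<subseteq> F" using C by (auto simp: Chains_def relation_of_def)
    have tot: "P p q \<or> P q p" if "p \<in> C" "q \<in> C" for p q
      using C that by (auto simp: Chains_def relation_of_def)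
    show "\<exists>u\<in>F. \<forall>p\<in>C. P p u"
    proof (cases "C = {}")
      case True
      then show ?thesis using p0 by (auto simp: F_def)
    next
      case False
      define r where "r x = (INF p\<in>C. p x)" for x
      have bdd: "bdd_below ((\<lambda>p. p x) ` C)" for x
        using lower CF by (intro bdd_belowI2[of _ "- norm x"]) auto
      have rle: "r x \<le> p x" if "p \<in> C" for p x
        unfolding r_def using bdd that by (rule cINF_lower)
      have radd: "r (x + y) \<le> r x + r y" for x y
      proof -
        \<comment> \<open>Totality of the chain: the smaller of p and q lies below both.\<close>
        have "r (x + y) - p x \<le> q y" if "p \<in> C" "q \<in> C" for p q
        proof -
          obtain s where s: "s \<in> C" "s x \<le> p x" "s y \<le> q y"
            using tot[OF \<open>p \<in> C\<close> \<open>q \<in> C\<close>] \<open>p \<in> C\<close> \<open>q \<in> C\<close> by (auto simp: P_def)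
          have "r (x + y) \<le> s (x + y)" using rle s by blast
          also have "\<dots> \<le> s x + s y" using s CF by (auto simp: F_def sublinear_def)
          finally show ?thesis using s by linarith
        qed
        then have "r (x + y) - p x \<le> r y" if "p \<in> C" for p
          unfolding r_def[of y] using that False by (intro cINF_greatest)
        then have "r (x + y) - r y \<le> p x" if "p \<in> C" for p using that by fastforce
        then have "r (x + y) - r y \<le> r x"
          unfolding r_def[of x] using False by (intro cINF_greatest)
        then show ?thesis by simp
      qed
      have rs: "r (c *\<^sub>R x) \<le> c * r x" if c: "c > 0" for c x
      proof -
        have "r (c *\<^sub>R x) / c \<le> p x" if "p \<in> C" for p
        proof -
          have "p (c *\<^sub>R x) = c * p x" using that CF c by (auto simp: F_def sublinear_def)
          then show ?thesis using rle[OF that, of "c *\<^sub>R x"] c by (simp add: field_simps)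
        qed
        then have "r (c *\<^sub>R x) / c \<le> r x"
          unfolding r_def[of x] using False by (intro cINF_greatest)
        then show ?thesis using c by (simp add: field_simps)
      qed
      have "r (c *\<^sub>R x) = c * r x" if c: "c > 0" for c x
        using rs[OF c, of x] rs[of "1/c" "c *\<^sub>R x"] c by (simp add: field_simps)
      with radd have "sublinear r" by (simp add: sublinear_def)
      moreover have "r x \<le> p0 x" for x
      proof -
        obtain p where "p \<in> C" using False by blast
        then have "r x \<le> p x" "p x \<le> p0 x" using rle CF by (auto simp: F_def)
        then show ?thesis by linarith
      qed
      ultimately show ?thesis using rle by (auto simp: F_def P_def)
    qed
  qed
  then obtain m where m: "m \<in> F" "\<And>p. p \<in> F \<Longrightarrow> (\<And>x. p x \<le> m x) \<Longrightarrow> p = m"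
    by (auto simp: P_def)
  have sub: "sublinear m" using m by (simp add: F_def)
  have mn: "m x \<le> norm x" for x using m(1) p0(2)[of x] by (force simp: F_def intro: order_trans)
  have neg: "m (- x) = - m x" for x
  proof (rule antisym)
    \<comment> \<open>Lowering m in direction x stays in \<open>F\<close>; by minimality nothing
      changes, so m is odd.\<close>
    obtain q where q: "sublinear q" "\<And>y. q y \<le> m y" "q (- x) \<le> - m x"
      using sublinear_reduce[OF sub] by blast
    have "q \<in> F" using q m(1) by (auto simp: F_def intro: order_trans)
    then have "q = m" using q m(2) by blast
    then show "m (- x) \<le> - m x" using q by simp
    have "m (x + - x) \<le> m x + m (- x)" using sub unfolding sublinear_def by blast
    then show "- m x \<le> m (- x)" using sublinear_zero[OF sub] by simp
  qed
  have add: "m (x + y) = m x + m y" for x y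
  proof (rule antisym)
    show "m (x + y) \<le> m x + m y" using sub by (simp add: sublinear_def)
    have "m (- x + - y) \<le> m (- x) + m (- y)" using sub unfolding sublinear_def by blast
    then show "m x + m y \<le> m (x + y)" using neg[of "x + y"] neg by (simp add: algebra_simps)
  qed
  have scale: "m (t *\<^sub>R x) = t * m x" for t x
  proof -
    have pos: "m (t *\<^sub>R x) = t * m x" if "t > 0" for t
      using sub that by (simp add: sublinear_def)
    show ?thesis
      using pos[of t] pos[of "- t"] neg[of "t *\<^sub>R x"] sublinear_zero[OF sub]
      by (cases t "0::real" rule: linorder_cases) auto
  qed
  have abs: "\<bar>m x\<bar> \<le> norm x" for x
    using mn[of x] lower[OF m(1), of x] by simp
  show ?thesis
  proof
    show "bounded_linear m"
      by (rule bounded_linear_intro[where K=1]) (auto simp: add scale abs)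
    show "\<bar>m x\<bar> \<le> norm x" for x by (rule abs)
    have "m (- a) \<le> p0 (- a)" using m(1) by (auto simp: F_def)
    then show "m a = norm a" using neg[of a] p0(3) mn[of a] by linarith
  qed
qed

subsection \<open>Bilinear forms from the parallelogram law\<close>

text \<open>c vanishes on the integers, hence has period 1 and is bounded everywhere, while the
  multiples n c(t) are unbounded unless c(t) = 0. In the polarisation argument this replaces
  continuity.\<close>

lemma additive_locally_bounded_imp_zero:
  fixes c :: "real \<Rightarrow> real"
  assumes add: "\<And>s t. c (s + t) = c s + c t" and c1: "c 1 = 0"
    and bd: "\<And>t. 0 \<le> t \<Longrightarrow> t \<le> 1 \<Longrightarrow> \<bar>c t\<bar> \<le> M"
  shows "c t = 0"
proof (rule ccontr)
  assume nz: "c t \<noteq> 0"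
  have c0: "c 0 = 0" using add[of 0 0] by simp
  have cn: "c (real n * s) = real n * c s" for n s
    by (induction n) (simp_all add: c0 add algebra_simps)
  have cneg: "c (- s) = - c s" for s using add[of s "- s"] c0 by simp
  have ci: "c (real_of_int k) = 0" for k
  proof (cases "k \<ge> 0")
    case True then show ?thesis using cn[of "nat k" 1] c1 by simp
  next
    case False then show ?thesis using cn[of "nat (- k)" 1] c1 cneg[of "real_of_int k"] by simp
  qed
  have bound: "\<bar>c s\<bar> \<le> M" for s
  proof -
    have "c s = c (frac s)" using add[of "frac s" "real_of_int \<lfloor>s\<rfloor>"] ci by (simp add: frac_def)
    moreover have "0 \<le> frac s" "frac s \<le> 1" by (simp_all add: frac_ge_0 less_imp_le frac_lt_1)
    ultimately show ?thesis using bd by simp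
  qed
  obtain n :: nat where n: "M < real n * \<bar>c t\<bar>"
    using reals_Archimedean3[of "\<bar>c t\<bar>"] nz by auto
  have "\<bar>c (real n * t)\<bar> = real n * \<bar>c t\<bar>" by (simp add: cn abs_mult)
  then show False using bound[of "real n * t"] n by simp
qed

text \<open>The setting of the Jordan--von Neumann theorem on a subspace, with \<open>Q\<close> the
  square of the prospective norm. Neither a triangle inequality nor continuity is postulated;
  homogeneity of the polarised form \<open>b\<close> comes from its bound by
  \<open>Q\<close>.\<close>

locale parallelogram_space =
  fixes V :: "'a::real_vector set" and Q :: "'a \<Rightarrow> real"
  assumes V: "subspace V"
    and Q_nonneg: "x \<in> V \<Longrightarrow> 0 \<le> Q x"
    and Q_scale: "x \<in> V \<Longrightarrow> Q (c *\<^sub>R x) = c\<^sup>2 * Q x"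
    and parallelogram: "x \<in> V \<Longrightarrow> y \<in> V \<Longrightarrow> Q (x + y) + Q (x - y) = 2 * Q x + 2 * Q y"
begin

lemmas V_intros = subspace_add[OF V] subspace_diff[OF V] subspace_scale[OF V] subspace_0[OF V] subspace_neg[OF V]

definition b :: "'a \<Rightarrow> 'a \<Rightarrow> real" where
  "b x y = (Q (x + y) - Q (x - y)) / 4"

lemma Q_0: "Q 0 = 0" using Q_scale[of 0 0] V_intros(4) by simp

lemma Q_minus: "x \<in> V \<Longrightarrow> Q (- x) = Q x" using Q_scale[of x "-1"] by simp

lemma Q_add: "x \<in> V \<Longrightarrow> y \<in> V \<Longrightarrow> Q (x + y) = Q x + Q y + 2 * b x y"
  using parallelogram[of x y] by (simp add: b_def field_simps)

lemma b_commute: "x \<in> V \<Longrightarrow> y \<in> V \<Longrightarrow> b x y = b y x"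
  using Q_minus[of "x - y"] by (simp add: b_def add.commute V_intros)

lemma b_self: "x \<in> V \<Longrightarrow> b x x = Q x"
  using Q_scale[of x 2] by (simp add: b_def Q_0 scaleR_2)

lemma b_0: "x \<in> V \<Longrightarrow> b 0 x = 0"
  using Q_minus[of x] by (simp add: b_def)

lemma b_midpoint:
  assumes "x \<in> V" "y \<in> V" "z \<in> V"
  shows "b (x + y) z + b (x - y) z = 2 * b x z"
proof -
  have "Q (x + y + z) + Q (x - y + z) = 2 * Q (x + z) + 2 * Q y"
    "Q (x + y - z) + Q (x - y - z) = 2 * Q (x - z) + 2 * Q y"
    using parallelogram[of "x + z" y] parallelogram[of "x - z" y] assms
    by (simp_all add: V_intros algebra_simps)
  then show ?thesis unfolding b_def by (simp add: field_simps)
qed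

text \<open>Equal arguments in \<open>b_midpoint\<close> give the doubling rule; half sum and half
  difference of x and y then turn it into additivity.\<close>

lemma b_add:
  assumes "x \<in> V" "y \<in> V" "z \<in> V"
  shows "b (x + y) z = b x z + b y z"
proof -
  have "b (2 *\<^sub>R ((1/2) *\<^sub>R (x + y))) z = 2 * b ((1/2) *\<^sub>R (x + y)) z"
    using b_midpoint[of "(1/2) *\<^sub>R (x + y)" "(1/2) *\<^sub>R (x + y)" z] assms b_0[of z]
    by (simp add: V_intros flip: scaleR_2)
  moreover have "b x z + b y z = 2 * b ((1/2) *\<^sub>R (x + y)) z"
  proof -
    have "(1/2) *\<^sub>R (x + y) + (1/2) *\<^sub>R (x - y) = x"
      "(1/2) *\<^sub>R (x + y) - (1/2) *\<^sub>R (x - y) = y"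
      by (simp_all add: algebra_simps flip: scaleR_left_distrib)
    then show ?thesis
      using b_midpoint[of "(1/2) *\<^sub>R (x + y)" "(1/2) *\<^sub>R (x - y)" z] assms
      by (simp only: V_intros)
  qed
  ultimately show ?thesis by simp
qed

lemma b_bound:
  assumes "x \<in> V" "y \<in> V" shows "2 * \<bar>b x y\<bar> \<le> Q x + Q y"
  using parallelogram[OF assms] Q_nonneg[of "x + y"] Q_nonneg[of "x - y"] assms
  by (simp add: b_def V_intros)

lemma b_scale:
  assumes x: "x \<in> V" and z: "z \<in> V"
  shows "b (t *\<^sub>R x) z = t * b x z"
proof -
  \<comment> \<open>The defect from homogeneity is additive in t, vanishes at 1 and is bounded on
    [0, 1] by \<open>b_bound\<close>.\<close>
  define c where "c t = b (t *\<^sub>R x) z - t * b x z" for t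
  have "c t = 0"
  proof (rule additive_locally_bounded_imp_zero[where c = c])
    show "c (s + t) = c s + c t" for s t
      using b_add[of "s *\<^sub>R x" "t *\<^sub>R x" z] x z by (simp add: c_def V_intros algebra_simps)
    show "c 1 = 0" by (simp add: c_def)
    fix t :: real assume t: "0 \<le> t" "t \<le> 1"
    have "2 * \<bar>b (t *\<^sub>R x) z\<bar> \<le> t\<^sup>2 * Q x + Q z"
      using b_bound[of "t *\<^sub>R x" z] x z by (simp add: V_intros Q_scale)
    moreover have "t\<^sup>2 * Q x \<le> 1 * Q x"
      using t Q_nonneg[OF x] by (intro mult_right_mono) (auto simp: power_le_one)
    moreover have "\<bar>t * b x z\<bar> \<le> \<bar>b x z\<bar>"
      using t by (simp add: abs_mult mult_left_le_one_le)
    ultimately have "\<bar>b (t *\<^sub>R x) z\<bar> + \<bar>t * b x z\<bar> \<le> (Q x + Q z) / 2 + \<bar>b x z\<bar>"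
      by (intro add_mono) (auto simp: field_simps)
    then show "\<bar>c t\<bar> \<le> (Q x + Q z) / 2 + \<bar>b x z\<bar>"
      unfolding c_def by (rule order_trans[OF abs_triangle_ineq4])
  qed
  then show ?thesis by (simp add: c_def)
qed

lemma b_diff: "x \<in> V \<Longrightarrow> y \<in> V \<Longrightarrow> z \<in> V \<Longrightarrow> b (x - y) z = b x z - b y z"
  using b_add[of x "- y" z] b_scale[of y z "-1"] by (simp add: V_intros)

lemma b_sum:
  assumes "finite H" "H \<subseteq> V" "z \<in> V"
  shows "b (\<Sum>h\<in>H. a h *\<^sub>R h) z = (\<Sum>h\<in>H. a h * b h z)"
  using assms
proof (induction H)
  case (insert h H)
  have "(\<Sum>h\<in>H. a h *\<^sub>R h) \<in> V"
    using insert.prems by (intro subspace_sum[OF V]) (auto simp: V_intros)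
  then show ?case using insert by (simp add: b_add b_scale V_intros)
qed (simp add: b_0)

definition orthonormal :: "'a set \<Rightarrow> bool" where
  "orthonormal H \<longleftrightarrow> finite H \<and> H \<subseteq> V \<and> (\<forall>h\<in>H. Q h = 1) \<and> (\<forall>h\<in>H. \<forall>k\<in>H. h \<noteq> k \<longrightarrow> b h k = 0)"

lemma sum_in_V:
  assumes "H \<subseteq> V" shows "(\<Sum>h\<in>H. a h *\<^sub>R h) \<in> V"
  using assms by (intro subspace_sum[OF V]) (auto simp: V_intros)

lemma orthonormal_coeff:
  assumes "orthonormal H" "k \<in> H"
  shows "b (\<Sum>h\<in>H. a h *\<^sub>R h) k = a k"
proof -
  have "b (\<Sum>h\<in>H. a h *\<^sub>R h) k = (\<Sum>h\<in>H. a h * b h k)"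
    using assms by (intro b_sum) (auto simp: orthonormal_def)
  also have "\<dots> = (\<Sum>h\<in>H. if h = k then a k else 0)"
    using assms by (intro sum.cong) (auto simp: orthonormal_def b_self subset_iff)
  finally show ?thesis using assms by (simp add: orthonormal_def)
qed

lemma Q_orthonormal_sum:
  assumes "orthonormal H"
  shows "Q (\<Sum>h\<in>H. a h *\<^sub>R h) = (\<Sum>h\<in>H. (a h)\<^sup>2)"
proof -
  let ?s = "\<Sum>h\<in>H. a h *\<^sub>R h"
  have H: "finite H" "H \<subseteq> V" using assms by (auto simp: orthonormal_def)
  have s: "?s \<in> V" using H by (intro sum_in_V)
  have "Q ?s = b ?s ?s" using s by (simp add: b_self)
  also have "\<dots> = (\<Sum>h\<in>H. a h * b h ?s)" using H s by (intro b_sum)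
  also have "\<dots> = (\<Sum>h\<in>H. (a h)\<^sup>2)"
  proof (rule sum.cong)
    fix h assume h: "h \<in> H"
    then have "b h ?s = b ?s h" using s H by (intro b_commute) auto
    then show "a h * b h ?s = (a h)\<^sup>2"
      using orthonormal_coeff[OF assms h] by (simp add: power2_eq_square)
  qed simp
  finally show ?thesis .
qed

definition proj :: "'a set \<Rightarrow> 'a \<Rightarrow> 'a" where
  "proj H x = (\<Sum>h\<in>H. b x h *\<^sub>R h)"

lemma proj_in_V: "H \<subseteq> V \<Longrightarrow> proj H x \<in> V"
  unfolding proj_def by (rule sum_in_V)

lemma b_proj_complement:
  assumes "orthonormal H" "x \<in> V" "k \<in> H"
  shows "b (x - proj H x) k = 0"
proof -
  have "H \<subseteq> V" using assms by (simp add: orthonormal_def)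
  then show ?thesis
    using assms orthonormal_coeff[OF assms(1,3), of "b x"]
    by (subst b_diff) (auto simp: proj_in_V, simp add: proj_def)
qed

text \<open>Pythagoras: \<open>proj H x\<close> and its complement are orthogonal for
  \<open>b\<close>.\<close>

lemma Q_proj_complement_le:
  assumes "orthonormal H" "x \<in> V"
  shows "Q (x - proj H x) \<le> Q x"
proof -
  have H: "H \<subseteq> V" "finite H" using assms by (auto simp: orthonormal_def)
  define y where "y = x - proj H x"
  have y: "y \<in> V" and p: "proj H x \<in> V" using H assms by (simp_all add: y_def proj_in_V V_intros)
  have "b (proj H x) y = (\<Sum>h\<in>H. b x h * b h y)"
    unfolding proj_def using H y by (intro b_sum)
  also have "\<dots> = 0"
  proof (rule sum.neutral, rule)
    fix h assume h: "h \<in> H"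
    then have "b h y = b y h" using y H by (intro b_commute) auto
    then show "b x h * b h y = 0" using b_proj_complement[OF assms h] by (simp add: y_def)
  qed
  finally have "Q (proj H x + y) = Q (proj H x) + Q y"
    using Q_add[OF p y] by simp
  then show ?thesis using Q_nonneg[OF p] by (simp add: y_def)
qed

lemma proj_add: "H \<subseteq> V \<Longrightarrow> x \<in> V \<Longrightarrow> y \<in> V \<Longrightarrow> proj H (x + y) = proj H x + proj H y"
  unfolding proj_def by (subst sum.distrib[symmetric]) (auto intro!: sum.cong simp: b_add scaleR_add_left subset_iff)

lemma proj_scale: "H \<subseteq> V \<Longrightarrow> x \<in> V \<Longrightarrow> proj H (t *\<^sub>R x) = t *\<^sub>R proj H x"
  unfolding proj_def by (subst scaleR_sum_right) (auto intro!: sum.cong simp: b_scale subset_iff)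

end

subsection \<open>The Hilbert seminorm on a principal ideal\<close>

text \<open>Model: functions on a measure space with \<phi> the integral. The principal ideal of u
  then carries the gauge norm of u, \<phi>(|f|) is the L^1 norm, and the form constructed below is
  the square of the L^2 norm with weight 1/u.\<close>

locale weighted_ideal =
  fixes u :: "'a::banach_lattice" and \<phi> :: "'a \<Rightarrow> real"
  assumes u_nonneg: "0 \<le> u" and u_nonzero: "u \<noteq> 0"
    and phi_bl: "bounded_linear \<phi>"
    and phi_strict: "0 \<le> f \<Longrightarrow> f \<noteq> 0 \<Longrightarrow> 0 < \<phi> f"
begin

sublocale phi: bounded_linear \<phi> by (rule phi_bl)

lemma phi_nonneg: "0 \<le> f \<Longrightarrow> 0 \<le> \<phi> f"
  using phi_strict[of f] phi.zero by (cases "f = 0") auto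

lemma phi_mono: "f \<le> g \<Longrightarrow> \<phi> f \<le> \<phi> g"
  using phi_nonneg[of "g - f"] by (simp add: phi.diff)

lemma phi_u: "0 < \<phi> u"
  using phi_strict u_nonneg u_nonzero by blast

definition ideal :: "'a set" where
  "ideal = {f. \<exists>c\<ge>0. lmod f \<le> c *\<^sub>R u}"

lemma idealI: "lmod f \<le> c *\<^sub>R u \<Longrightarrow> f \<in> ideal"
  unfolding ideal_def
  by (auto intro!: exI[of _ "max c 0"] elim: scaleR_le_scaleR simp: u_nonneg)

lemma idealE:
  assumes "f \<in> ideal" obtains c where "c \<ge> 0" "lmod f \<le> c *\<^sub>R u"
  using assms by (auto simp: ideal_def)

lemma subspace_ideal: "subspace ideal"
  unfolding subspace_def
proof (intro conjI ballI allI)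
  show "0 \<in> ideal" by (rule idealI[of _ 0]) simp
  fix x assume "x \<in> ideal"
  then obtain c where c: "c \<ge> 0" "lmod x \<le> c *\<^sub>R u" by (rule idealE)
  show "a *\<^sub>R x \<in> ideal" for a
  proof (rule idealI)
    have "lmod (a *\<^sub>R x) \<le> \<bar>a\<bar> *\<^sub>R lmod x" by (rule lmod_scaleR_le)
    also have "\<dots> \<le> \<bar>a\<bar> *\<^sub>R (c *\<^sub>R u)" using c by (intro scaleR_left_mono) auto
    finally show "lmod (a *\<^sub>R x) \<le> (\<bar>a\<bar> * c) *\<^sub>R u" by simp
  qed
  fix y assume "y \<in> ideal"
  then obtain d where d: "d \<ge> 0" "lmod y \<le> d *\<^sub>R u" by (rule idealE)
  show "x + y \<in> ideal"
  proof (rule idealI)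
    show "lmod (x + y) \<le> (c + d) *\<^sub>R u"
      using order_trans[OF lmod_triangle add_mono[OF c(2) d(2)]] by (simp add: scaleR_add_left)
  qed
qed

text \<open>In a space of functions the supremum over all real t of the following tangents is
  the function f^2 / u, so that Q f is the integral of f^2 / u.  Taking suprema of
  finitely many tangents avoids any appeal to order completeness or to representation
  theorems, and Q still satisfies the parallelogram law.\<close>

definition tangent :: "'a \<Rightarrow> real \<Rightarrow> 'a" where
  "tangent f t = (2 * t) *\<^sub>R f - t\<^sup>2 *\<^sub>R u"

definition envelope :: "'a \<Rightarrow> real set \<Rightarrow> 'a" where
  "envelope f F = Sup_fin (tangent f ` F)"

definition Q :: "'a \<Rightarrow> real" where
  "Q f = (SUP F\<in>{F. finite F \<and> F \<noteq> {}}. \<phi> (envelope f F))"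

lemma tangent_le_envelope: "finite F \<Longrightarrow> t \<in> F \<Longrightarrow> tangent f t \<le> envelope f F"
  unfolding envelope_def by (intro Sup_fin.coboundedI) auto

lemma envelope_le: "finite F \<Longrightarrow> F \<noteq> {} \<Longrightarrow> (\<And>t. t \<in> F \<Longrightarrow> tangent f t \<le> w) \<Longrightarrow> envelope f F \<le> w"
  unfolding envelope_def by (intro Sup_fin.boundedI) auto

text \<open>Pointwise, 2tf - t^2 u <= f^2/u <= c|f|. Without division: if 2|t| <= c the quadratic
  term is dropped; otherwise the excess (2|t| - c)|f| is at most (2|t| - c) c u, which t^2 u absorbs
  because (|t| - c)^2 >= 0.\<close>

lemma tangent_le:
  assumes c: "c \<ge> 0" "lmod f \<le> c *\<^sub>R u"
  shows "tangent f t \<le> c *\<^sub>R lmod f"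
proof -
  have "(2 * t) *\<^sub>R f \<le> \<bar>2 * t\<bar> *\<^sub>R lmod f"
    using lmod_scaleR_le lmod_upper(1) order_trans by blast
  then have 1: "tangent f t \<le> (2 * \<bar>t\<bar>) *\<^sub>R lmod f - t\<^sup>2 *\<^sub>R u"
    by (simp add: tangent_def abs_mult)
  show ?thesis
  proof (cases "2 * \<bar>t\<bar> \<le> c")
    case True
    then have "(2 * \<bar>t\<bar>) *\<^sub>R lmod f \<le> c *\<^sub>R lmod f" by (intro scaleR_right_mono) auto
    moreover have "0 \<le> t\<^sup>2 *\<^sub>R u" using u_nonneg by (simp add: scaleR_nonneg_nonneg)
    ultimately have "(2 * \<bar>t\<bar>) *\<^sub>R lmod f - t\<^sup>2 *\<^sub>R u \<le> c *\<^sub>R lmod f - 0" by (rule diff_mono)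
    with 1 show ?thesis by simp
  next
    case False
    have "(2 * \<bar>t\<bar> - c) *\<^sub>R lmod f \<le> (2 * \<bar>t\<bar> - c) *\<^sub>R (c *\<^sub>R u)"
      using False c by (intro scaleR_left_mono) auto
    also have "\<dots> \<le> t\<^sup>2 *\<^sub>R u"
    proof -
      have "(2 * \<bar>t\<bar> - c) * c \<le> t\<^sup>2"
        using zero_le_power2[of "\<bar>t\<bar> - c"] by (simp add: power2_eq_square algebra_simps)
      then show ?thesis using u_nonneg by (simp add: scaleR_right_mono)
    qed
    finally have "(2 * \<bar>t\<bar>) *\<^sub>R lmod f - t\<^sup>2 *\<^sub>R u \<le> c *\<^sub>R lmod f"
      by (simp add: scaleR_diff_left algebra_simps)
    with 1 show ?thesis by simp
  qed
qed

lemma phi_envelope_le: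
  assumes c: "c \<ge> 0" "lmod f \<le> c *\<^sub>R u" and F: "finite F" "F \<noteq> {}"
  shows "\<phi> (envelope f F) \<le> c * \<phi> (lmod f)"
  using phi_mono[OF envelope_le[OF F tangent_le[OF c]]] by (simp add: phi.scaleR)

lemma finite_nonempty_sets: "{F::real set. finite F \<and> F \<noteq> {}} \<noteq> {}"
  by (auto intro: exI[of _ "{0}"])

lemma Q_le_phi:
  assumes c: "c \<ge> 0" "lmod f \<le> c *\<^sub>R u"
  shows "Q f \<le> c * \<phi> (lmod f)"
  unfolding Q_def using phi_envelope_le[OF c] by (intro cSUP_least finite_nonempty_sets) auto

text \<open>Membership in the ideal bounds the set of which \<open>Q f\<close> is the supremum;
  without it the supremum could be that of an unbounded set.\<close>

lemma phi_envelope_le_Q: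
  assumes "f \<in> ideal" "finite F" "F \<noteq> {}"
  shows "\<phi> (envelope f F) \<le> Q f"
proof -
  obtain c where c: "c \<ge> 0" "lmod f \<le> c *\<^sub>R u" using assms(1) by (rule idealE)
  show ?thesis
    unfolding Q_def
  proof (rule cSUP_upper)
    show "bdd_above ((\<lambda>F. \<phi> (envelope f F)) ` {F. finite F \<and> F \<noteq> {}})"
      using phi_envelope_le[OF c] by (intro bdd_aboveI2) auto
  qed (use assms in auto)
qed

lemma Q_nonneg: "f \<in> ideal \<Longrightarrow> 0 \<le> Q f"
  using phi_envelope_le_Q[of f "{0}"] by (simp add: envelope_def tangent_def phi.zero)

text \<open>The tangent of c f at t is c^2 times the tangent of f at t/c, so only the parameter set
  is rescaled.\<close>

lemma Q_scale_le:
  assumes f: "f \<in> ideal" and c: "c \<noteq> 0" shows "Q (c *\<^sub>R f) \<le> c\<^sup>2 * Q f"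
  unfolding Q_def[of "c *\<^sub>R f"]
proof (rule cSUP_least[OF finite_nonempty_sets])
  fix F :: "real set" assume "F \<in> {F. finite F \<and> F \<noteq> {}}"
  then have F: "finite F" "F \<noteq> {}" by auto
  let ?G = "(\<lambda>t. t / c) ` F"
  have "envelope (c *\<^sub>R f) F \<le> c\<^sup>2 *\<^sub>R envelope f ?G"
  proof (rule envelope_le[OF F])
    fix t assume t: "t \<in> F"
    have "tangent (c *\<^sub>R f) t = c\<^sup>2 *\<^sub>R tangent f (t / c)"
      using c by (simp add: tangent_def scaleR_diff_right power2_eq_square field_simps)
    also have "\<dots> \<le> c\<^sup>2 *\<^sub>R envelope f ?G"
      using t F by (intro scaleR_left_mono tangent_le_envelope) auto
    finally show "tangent (c *\<^sub>R f) t \<le> c\<^sup>2 *\<^sub>R envelope f ?G" .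
  qed
  then have "\<phi> (envelope (c *\<^sub>R f) F) \<le> c\<^sup>2 * \<phi> (envelope f ?G)"
    using phi_mono by (fastforce simp: phi.scaleR)
  also have "\<dots> \<le> c\<^sup>2 * Q f"
    using f F by (intro mult_left_mono phi_envelope_le_Q) auto
  finally show "\<phi> (envelope (c *\<^sub>R f) F) \<le> c\<^sup>2 * Q f" .
qed

lemma Q_zero: "Q 0 = 0"
  using Q_le_phi[of 0 0] Q_nonneg[of 0] subspace_0[OF subspace_ideal] by simp

lemma Q_scale:
  assumes f: "f \<in> ideal" shows "Q (c *\<^sub>R f) = c\<^sup>2 * Q f"
proof (cases "c = 0")
  case True then show ?thesis by (simp add: Q_zero)
next
  case False
  have "c *\<^sub>R f \<in> ideal" using f by (rule subspace_scale[OF subspace_ideal])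
  from Q_scale_le[OF this, of "1 / c"] False have "c\<^sup>2 * Q f \<le> Q (c *\<^sub>R f)"
    by (simp add: field_simps)
  with Q_scale_le[OF f False] show ?thesis by simp
qed

text \<open>Tangents satisfy a parallelogram identity exactly: that of f + g at s plus that of f - g
  at t is twice that of f at (s + t)/2 plus twice that of g at (s - t)/2. This change of parameters
  keeps finite sets finite.\<close>

lemma Q_parallelogram_le:
  assumes f: "f \<in> ideal" and g: "g \<in> ideal"
  shows "Q (f + g) + Q (f - g) \<le> 2 * Q f + 2 * Q g"
proof -
  let ?R = "2 * Q f + 2 * Q g"
  have main: "\<phi> (envelope (f + g) F) + \<phi> (envelope (f - g) G) \<le> ?R"
    if F: "finite F" "F \<noteq> {}" and G: "finite G" "G \<noteq> {}" for F G
  proof -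
    let ?F = "(\<lambda>(s, t). (s + t) / 2) ` (F \<times> G)" and ?G = "(\<lambda>(s, t). (s - t) / 2) ` (F \<times> G)"
    let ?w = "2 *\<^sub>R envelope f ?F + 2 *\<^sub>R envelope g ?G"
    have fin: "finite ?F" "finite ?G" "?F \<noteq> {}" "?G \<noteq> {}" using F G by auto
    have st: "tangent (f + g) s + tangent (f - g) t \<le> ?w" if "s \<in> F" "t \<in> G" for s t
    proof -
      have "tangent (f + g) s + tangent (f - g) t
        = 2 *\<^sub>R tangent f ((s + t) / 2) + 2 *\<^sub>R tangent g ((s - t) / 2)"
      proof -
        have "s\<^sup>2 + t\<^sup>2 = 2 * ((s + t) / 2)\<^sup>2 + 2 * ((s - t) / 2)\<^sup>2"
          by (simp add: power2_eq_square field_simps)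
        then have "s\<^sup>2 *\<^sub>R u + t\<^sup>2 *\<^sub>R u = (2 * ((s + t) / 2)\<^sup>2) *\<^sub>R u + (2 * ((s - t) / 2)\<^sup>2) *\<^sub>R u"
          by (simp flip: scaleR_add_left)
        moreover have "2 * (2 * ((s + t) / 2)) = 2 * s + 2 * t" "2 * (2 * ((s - t) / 2)) = 2 * s - 2 * t"
          by (simp_all add: field_simps)
        ultimately show ?thesis
          unfolding tangent_def scaleR_diff_right scaleR_scaleR
          by (simp only: scaleR_add_left scaleR_diff_left scaleR_add_right scaleR_diff_right) (simp add: algebra_simps)
      qed
      also have "\<dots> \<le> ?w"
        using that fin by (intro add_mono scaleR_left_mono tangent_le_envelope) auto
      finally show ?thesis .
    qed
    \<comment> \<open>The suprema over s and t are taken one after the other; \<open>?w\<close>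
      serves all pairs.\<close>
    have "envelope (f + g) F \<le> ?w - tangent (f - g) t" if "t \<in> G" for t
      using st[OF _ that] by (intro envelope_le F) (simp add: le_diff_eq)
    then have "envelope (f - g) G \<le> ?w - envelope (f + g) F"
      by (intro envelope_le G) (simp add: le_diff_eq add.commute)
    then have "envelope (f + g) F + envelope (f - g) G \<le> ?w"
      by (simp add: le_diff_eq add.commute)
    from phi_mono[OF this] have "\<phi> (envelope (f + g) F) + \<phi> (envelope (f - g) G)
        \<le> 2 * \<phi> (envelope f ?F) + 2 * \<phi> (envelope g ?G)"
      by (simp add: phi.add phi.scaleR)
    with phi_envelope_le_Q[OF f fin(1,3)] phi_envelope_le_Q[OF g fin(2,4)] show ?thesis
      by linarith
  qed
  have "Q (f + g) \<le> ?R - \<phi> (envelope (f - g) G)" if G: "finite G" "G \<noteq> {}" for G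
    unfolding Q_def[of "f + g"] using main[OF _ _ G]
    by (intro cSUP_least finite_nonempty_sets) (force simp: le_diff_eq)
  then have "Q (f - g) \<le> ?R - Q (f + g)"
    unfolding Q_def[of "f - g"] by (intro cSUP_least finite_nonempty_sets) (force simp: le_diff_eq)
  then show ?thesis by simp
qed

sublocale parallelogram_space ideal Q
proof
  show "subspace ideal" by (rule subspace_ideal)
  show "0 \<le> Q x" if "x \<in> ideal" for x using that by (rule Q_nonneg)
  show "Q (c *\<^sub>R x) = c\<^sup>2 * Q x" if "x \<in> ideal" for x c using that by (rule Q_scale)
  fix x y assume x: "x \<in> ideal" and y: "y \<in> ideal"
  have xy: "x + y \<in> ideal" "x - y \<in> ideal"
    using x y by (simp_all add: subspace_add[OF subspace_ideal] subspace_diff[OF subspace_ideal])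
  \<comment> \<open>Substituting sum and difference for x and y, with Q(2x) = 4 Q(x), gives the
    opposite inequality.\<close>
  have "Q (2 *\<^sub>R x) + Q (2 *\<^sub>R y) \<le> 2 * Q (x + y) + 2 * Q (x - y)"
    using Q_parallelogram_le[OF xy] by (simp add: scaleR_2)
  then show "Q (x + y) + Q (x - y) = 2 * Q x + 2 * Q y"
    using Q_parallelogram_le[OF x y] by (simp add: Q_scale x y)
qed

text \<open>Cauchy--Schwarz for the factorisation of |f| into |f|/sqrt u and sqrt u. The two
  tangents at t and -t already dominate 2t|f| - t^2 u, and the chosen t maximises 2t \<phi>(|f|) -
  t^2 \<phi>(u).\<close>

lemma phi_lmod_le_Q:
  assumes f: "f \<in> ideal" shows "(\<phi> (lmod f))\<^sup>2 \<le> \<phi> u * Q f"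
proof -
  define t where "t = \<phi> (lmod f) / \<phi> u"
  have t: "t \<ge> 0" using phi_u by (simp add: t_def phi_nonneg)
  have "(2 * t) *\<^sub>R lmod f - t\<^sup>2 *\<^sub>R u \<le> envelope f {t, - t}"
  proof -
    let ?w = "envelope f {t, - t} + t\<^sup>2 *\<^sub>R u"
    have "(2 * t) *\<^sub>R f \<le> ?w" "(2 * t) *\<^sub>R (- f) \<le> ?w"
      using tangent_le_envelope[of "{t, - t}" t f] tangent_le_envelope[of "{t, - t}" "- t" f]
      by (simp_all add: tangent_def diff_le_eq)
    then have "(2 * t) *\<^sub>R lmod f \<le> ?w"
    proof (cases "t = 0")
      case False
      then have "f \<le> (1 / (2 * t)) *\<^sub>R ?w" "- f \<le> (1 / (2 * t)) *\<^sub>R ?w"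
        using scaleR_left_mono[OF \<open>(2 * t) *\<^sub>R f \<le> ?w\<close>, of "1 / (2 * t)"]
          scaleR_left_mono[OF \<open>(2 * t) *\<^sub>R (- f) \<le> ?w\<close>, of "1 / (2 * t)"] t by simp_all
      then have "lmod f \<le> (1 / (2 * t)) *\<^sub>R ?w" by (simp only: lmod_le_iff)
      from scaleR_left_mono[OF this, of "2 * t"] t False show ?thesis by simp
    qed simp
    then show ?thesis by (simp add: diff_le_eq)
  qed
  from phi_mono[OF this] have "2 * t * \<phi> (lmod f) - t\<^sup>2 * \<phi> u \<le> Q f"
    using phi_envelope_le_Q[OF f, of "{t, - t}"] by (simp add: phi.diff phi.scaleR)
  then have "\<phi> u * (2 * t * \<phi> (lmod f) - t\<^sup>2 * \<phi> u) \<le> \<phi> u * Q f"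
    using phi_u by (intro mult_left_mono) auto
  moreover have "\<phi> u * (2 * t * \<phi> (lmod f) - t\<^sup>2 * \<phi> u) = (\<phi> (lmod f))\<^sup>2"
    using phi_u by (simp add: t_def power2_eq_square field_simps)
  ultimately show ?thesis by simp
qed

lemma phi_lmod_le_sqrt_Q:
  assumes "f \<in> ideal" shows "\<phi> (lmod f) \<le> sqrt (\<phi> u) * sqrt (Q f)"
  using real_le_rsqrt[OF phi_lmod_le_Q[OF assms]] by (simp add: real_sqrt_mult)

lemma Q_eq_0_imp:
  assumes "f \<in> ideal" "Q f = 0" shows "f = 0"
proof (rule ccontr)
  assume "f \<noteq> 0"
  then have "0 < \<phi> (lmod f)" by (intro phi_strict) auto
  then show False using phi_lmod_le_Q[OF assms(1)] assms(2) by simp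
qed

end

subsection \<open>A Fredholm alternative\<close>

text \<open>Orthogonal projection is known to be linear on the ideal only; an arbitrary algebraic
  extension makes it a total linear map. No continuity is gained, so later limits are controlled by
  order bounds.\<close>

lemma linear_extension_from_subspace:
  fixes f :: "'a::real_vector \<Rightarrow> 'b::real_vector"
  assumes V: "subspace V"
    and add: "\<And>x y. x \<in> V \<Longrightarrow> y \<in> V \<Longrightarrow> f (x + y) = f x + f y"
    and scale: "\<And>c x. x \<in> V \<Longrightarrow> f (c *\<^sub>R x) = c *\<^sub>R f x"
  obtains g where "linear g" "\<And>x. x \<in> V \<Longrightarrow> g x = f x"
proof -
  obtain B where B: "B \<subseteq> V" "independent B" "V \<subseteq> span B"
    using maximal_independent_subset[of V] by blast
  obtain g where g: "linear g" "\<forall>x\<in>B. g x = f x"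
    using linear_independent_extend[OF B(2)] by blast
  have "subspace {x \<in> V. g x = f x}"
    using V add scale[of 0 0] scale g(1)
    by (auto simp: subspace_def linear_add linear_scale linear_0)
  then have "span B \<subseteq> {x \<in> V. g x = f x}"
    using B(1) g(2) by (intro span_minimal) auto
  with B(3) g(1) that show ?thesis by blast
qed

text \<open>L keeps the dimension of the span and M cannot raise it, so an inclusion of the images
  is an equality. This transfers surjectivity from a reference operator M to L.\<close>

lemma finite_dim_injective_imp_surjective:
  fixes L M :: "'a::real_vector \<Rightarrow> 'b::real_vector"
  assumes L: "linear L" and M: "linear M" and X: "finite X"
    and inj: "\<And>x. x \<in> span X \<Longrightarrow> L x = 0 \<Longrightarrow> x = 0"
    and sub: "L ` span X \<subseteq> M ` span X"
  shows "M ` span X \<subseteq> L ` span X"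
proof
  obtain B where B: "B \<subseteq> X" "independent B" "X \<subseteq> span B"
    using maximal_independent_subset[of X] by blast
  have fB: "finite B" using B(1) X finite_subset by blast
  have sp: "span B = span X"
    using B by (intro antisym span_mono span_minimal) auto
  have injB: "inj_on L (span B)"
  proof (rule inj_onI)
    fix x y assume "x \<in> span B" "y \<in> span B" "L x = L y"
    then have "x - y = 0" by (intro inj) (simp_all add: sp span_diff linear_diff[OF L])
    then show "x = y" by simp
  qed
  have indL: "independent (L ` B)"
    using linear_independent_injective_image[OF L B(2) injB] .
  have cardL: "card (L ` B) = card B"
    using injB by (meson card_image inj_on_subset span_superset)
  have subM: "span (L ` B) \<subseteq> span (M ` B)"
    using sub by (simp add: linear_span_image L M sp)
  fix w assume "w \<in> M ` span X"
  then have w: "w \<in> span (M ` B)" by (simp add: linear_span_image M sp)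
  show "w \<in> L ` span X"
  proof (rule ccontr)
    assume "w \<notin> L ` span X"
    then have nw: "w \<notin> span (L ` B)" by (simp add: linear_span_image L sp)
    then have "independent (insert w (L ` B))" using indL by (simp add: independent_insert)
    moreover have "insert w (L ` B) \<subseteq> span (M ` B)" using w subM span_superset by blast
    ultimately have "card (insert w (L ` B)) \<le> card (M ` B)"
      using independent_span_bound[of "M ` B"] fB by blast
    moreover have "card (M ` B) \<le> card B" by (rule card_image_le[OF fB])
    moreover have "card (insert w (L ` B)) = Suc (card B)"
      using nw fB cardL span_base[of w "L ` B"] by (subst card_insert_disjoint) auto
    ultimately show False by simp
  qed
qed

text \<open>In function spaces signs are chosen pointwise; in a lattice it suffices to free one sign
  at a time. With the others fixed, both choices at h give |g h| <= w minus the remaining sum, and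
  the induction hypothesis is used with w - |g h|.\<close>

lemma sum_lmod_le_of_signs:
  fixes g :: "'i \<Rightarrow> 'a::banach_lattice"
  assumes "finite H" and "\<And>s. (\<And>h. h \<in> H \<Longrightarrow> \<bar>s h\<bar> = 1) \<Longrightarrow> (\<Sum>h\<in>H. s h *\<^sub>R g h) \<le> w"
  shows "(\<Sum>h\<in>H. lmod (g h)) \<le> w"
  using assms
proof (induction H arbitrary: w)
  case empty
  then show ?case using empty(1)[of "\<lambda>_. 1"] by simp
next
  case (insert h H)
  have "(\<Sum>h\<in>H. lmod (g h)) \<le> w - lmod (g h)"
  proof (rule insert.IH)
    fix s :: "'i \<Rightarrow> real" assume s: "\<And>h. h \<in> H \<Longrightarrow> \<bar>s h\<bar> = 1"
    let ?r = "\<Sum>h\<in>H. s h *\<^sub>R g h"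
    have sign: "a *\<^sub>R g h + ?r \<le> w" if a: "\<bar>a\<bar> = 1" for a :: real
    proof -
      have "(\<Sum>k\<in>insert h H. (s(h := a)) k *\<^sub>R g k) \<le> w"
        using s a by (intro insert.prems) auto
      moreover have "(\<Sum>k\<in>H. (s(h := a)) k *\<^sub>R g k) = ?r"
        using insert.hyps by (intro sum.cong) auto
      ultimately show ?thesis using insert.hyps by simp
    qed
    have "lmod (g h) \<le> w - ?r"
      unfolding lmod_le_iff using sign[of 1] sign[of "-1"] by (simp add: le_diff_eq)
    then show "?r \<le> w - lmod (g h)" by (simp add: le_diff_eq add.commute)
  qed
  then show ?case using insert.hyps by (simp add: le_diff_eq add.commute)
qed

context weighted_ideal
begin

lemma Q_le_square:
  assumes "c \<ge> 0" "lmod f \<le> c *\<^sub>R u" shows "Q f \<le> c\<^sup>2 * \<phi> u"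
proof -
  have "\<phi> (lmod f) \<le> c * \<phi> u" using phi_mono[OF assms(2)] by (simp add: phi.scaleR)
  then have "c * \<phi> (lmod f) \<le> c * (c * \<phi> u)" using assms(1) by (rule mult_left_mono)
  then show ?thesis using Q_le_phi[OF assms] by (simp add: power2_eq_square)
qed

text \<open>The gauge norm of u controls the norm, so X converges in norm, and its order bounds
  survive because order intervals are norm closed. In effect the ideal is complete for its gauge
  norm.\<close>

lemma ideal_limit:
  assumes X: "\<And>n. X n \<in> ideal" and c: "c \<ge> 0"
    and step: "\<And>n. lmod (X (Suc n) - X n) \<le> (c * (1/2) ^ n) *\<^sub>R u"
  obtains x where "x \<in> ideal" "X \<longlonglongrightarrow> x" "\<And>n. lmod (x - X n) \<le> (2 * c * (1/2) ^ n) *\<^sub>R u"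
proof -
  have diff: "lmod (X (n + k) - X n) \<le> (2 * c * (1/2) ^ n) *\<^sub>R u" for n k
  proof -
    \<comment> \<open>The factor 1 - (1/2)^k is the exact partial geometric sum, so that the
      induction on k closes.\<close>
    have "lmod (X (n + k) - X n) \<le> (2 * c * (1/2) ^ n * (1 - (1/2) ^ k)) *\<^sub>R u"
    proof (induction k)
      case (Suc k)
      have "lmod (X (n + Suc k) - X n) = lmod ((X (Suc (n + k)) - X (n + k)) + (X (n + k) - X n))"
        by simp
      also have "\<dots> \<le> lmod (X (Suc (n + k)) - X (n + k)) + lmod (X (n + k) - X n)"
        by (rule lmod_triangle)
      also have "\<dots> \<le> (c * (1/2) ^ (n + k)) *\<^sub>R u + (2 * c * (1/2) ^ n * (1 - (1/2) ^ k)) *\<^sub>R u"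
        by (intro add_mono step Suc.IH)
      also have "\<dots> = (2 * c * (1/2) ^ n * (1 - (1/2) ^ Suc k)) *\<^sub>R u"
      proof -
        have "c * (1/2) ^ (n + k) + 2 * c * (1/2) ^ n * (1 - (1/2) ^ k)
          = 2 * c * (1/2) ^ n * (1 - (1/2) ^ Suc k)"
          by (simp add: power_add right_diff_distrib)
        then show ?thesis by (simp only: scaleR_add_left[symmetric])
      qed
      finally show ?case .
    qed simp
    moreover have "2 * c * (1/2) ^ n * (1 - (1/2) ^ k) \<le> 2 * c * (1/2) ^ n"
      using c by (simp add: mult_left_le)
    ultimately show ?thesis using u_nonneg by (rule scaleR_le_scaleR)
  qed
  have nd: "norm (X (n + k) - X n) \<le> 2 * c * norm u * (1/2) ^ n" for n k
    using norm_le_of_lmod_le[OF diff[of n k]] c by (simp add: mult_ac)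
  have "Cauchy X"
  proof (rule CauchyI')
    fix e :: real assume e: "e > 0"
    have "(\<lambda>n. 2 * c * norm u * (1/2) ^ n) \<longlonglongrightarrow> 0"
      by (intro tendsto_mult_right_zero LIMSEQ_realpow_zero) auto
    then have "eventually (\<lambda>n. 2 * c * norm u * (1/2) ^ n < e) sequentially"
      using e by (rule order_tendstoD)
    then obtain M where M: "\<And>n. n \<ge> M \<Longrightarrow> 2 * c * norm u * (1/2) ^ n < e"
      by (auto simp: eventually_sequentially)
    have "dist (X m) (X n) < e" if "m \<ge> M" "n > m" for m n
      using nd[of m "n - m"] M[of m] that by (simp add: dist_norm norm_minus_commute)
    then show "\<exists>M. \<forall>m\<ge>M. \<forall>n>m. dist (X m) (X n) < e" by blast
  qed
  then obtain x where x: "X \<longlonglongrightarrow> x" using Cauchy_convergent convergent_def by blast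
  have lim: "lmod (x - X n) \<le> (2 * c * (1/2) ^ n) *\<^sub>R u" for n
  proof -
    have "(\<lambda>k. X (n + k)) \<longlonglongrightarrow> x"
      using LIMSEQ_ignore_initial_segment[OF x, of n] by (simp add: add.commute)
    then have "(\<lambda>k. X (n + k) - X n) \<longlonglongrightarrow> x - X n" by (intro tendsto_intros)
    then show ?thesis
      using closed_sequentially[OF closed_lmod_le[of "(2 * c * (1/2) ^ n) *\<^sub>R u"], of "\<lambda>k. X (n + k) - X n"] diff
      by simp
  qed
  have "x - X 0 \<in> ideal" using lim by (rule idealI)
  then have "x \<in> ideal" using X[of 0] V_intros(1)[of "x - X 0" "X 0"] by simp
  with x lim that show ?thesis by blast
qed

end

section \<open>Operators with bounded kernel and their Fredholm theory\<close>

locale dominated_operator = weighted_ideal u \<phi>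
  for u :: "'a::banach_lattice" and \<phi> :: "'a \<Rightarrow> real" +
  fixes S :: "'a \<Rightarrow> 'a" and C :: real
  assumes S_bl: "bounded_linear S" and C_pos: "0 < C"
    and S_dom: "lmod (S f) \<le> (C * \<phi> (lmod f)) *\<^sub>R u"
begin

sublocale S: bounded_linear S by (rule S_bl)

lemma S_ideal: "S f \<in> ideal"
  using S_dom by (rule idealI)

text \<open>A bound for S from the Hilbert norm to the gauge norm of u; the square root is the
  Cauchy--Schwarz constant between \<phi>(|f|) and the Hilbert norm.\<close>

definition K :: real where "K = C * sqrt (\<phi> u)"

lemma K_pos: "0 < K" using C_pos phi_u by (simp add: K_def)

lemma S_dom_Q:
  assumes "f \<in> ideal" shows "lmod (S f) \<le> (K * sqrt (Q f)) *\<^sub>R u"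
proof (rule scaleR_le_scaleR[OF S_dom _ u_nonneg])
  show "C * \<phi> (lmod f) \<le> K * sqrt (Q f)"
    using mult_left_mono[OF phi_lmod_le_sqrt_Q[OF assms], of C] C_pos by (simp add: K_def mult.assoc)
qed

text \<open>Choosing signs turns the sum of the moduli of the S h into a single value of S at
  a vector of Hilbert norm sqrt (card H): this is the Hilbert--Schmidt property of S.\<close>
lemma orthonormal_card_le:
  fixes e :: real
  assumes H: "orthonormal H" and e: "\<And>h. h \<in> H \<Longrightarrow> e \<le> \<phi> (lmod (S h))" "e > 0"
  shows "real (card H) * e\<^sup>2 \<le> (K * \<phi> u)\<^sup>2"
proof -
  have fH: "finite H" "H \<subseteq> ideal" using H by (auto simp: orthonormal_def)
  let ?N = "real (card H)"
  have "(\<Sum>h\<in>H. lmod (S h)) \<le> (K * sqrt ?N) *\<^sub>R u"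
  proof (rule sum_lmod_le_of_signs[OF fH(1)])
    fix s :: "'a \<Rightarrow> real" assume s: "\<And>h. h \<in> H \<Longrightarrow> \<bar>s h\<bar> = 1"
    let ?f = "\<Sum>h\<in>H. s h *\<^sub>R h"
    have "(s h)\<^sup>2 = 1" if "h \<in> H" for h using s[OF that] by (metis one_power2 power2_abs)
    \<comment> \<open>Every signed sum has Hilbert norm \<open>sqrt ?N\<close>, whereas the left
      side to be estimated grows like \<open>?N * e\<close>; this is what limits the
      cardinality.\<close>
    then have "Q ?f = ?N" using Q_orthonormal_sum[OF H, of s] by simp
    moreover have "?f \<in> ideal" using fH by (intro sum_in_V)
    ultimately have "lmod (S ?f) \<le> (K * sqrt ?N) *\<^sub>R u" using S_dom_Q by fastforce
    then have "S ?f \<le> (K * sqrt ?N) *\<^sub>R u" using lmod_upper(1) order_trans by blast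
    then show "(\<Sum>h\<in>H. s h *\<^sub>R S h) \<le> (K * sqrt ?N) *\<^sub>R u"
      by (simp add: S.sum S.scaleR)
  qed
  from phi_mono[OF this] have 1: "(\<Sum>h\<in>H. \<phi> (lmod (S h))) \<le> K * sqrt ?N * \<phi> u"
    by (simp add: phi.sum phi.scaleR)
  have "?N * e \<le> (\<Sum>h\<in>H. \<phi> (lmod (S h)))"
    using e(1) by (simp add: sum_bounded_below)
  with 1 have 2: "?N * e \<le> (K * \<phi> u) * sqrt ?N" by (simp add: mult_ac)
  show ?thesis
  proof (cases "card H = 0")
    case False
    have "sqrt ?N * (sqrt ?N * e) \<le> sqrt ?N * (K * \<phi> u)"
      using 2 by (simp only: mult.assoc[symmetric] real_sqrt_mult_self) (simp add: mult_ac)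
    then have "sqrt ?N * e \<le> K * \<phi> u" using False by simp
    then have "(sqrt ?N * e)\<^sup>2 \<le> (K * \<phi> u)\<^sup>2" using e(2) by (intro power_mono) auto
    then show ?thesis by (simp add: power_mult_distrib)
  qed simp
qed

text \<open>Orthonormal families on which \<phi>(|S h|) >= e have bounded cardinality, so a largest
  one exists. A vector orthogonal to it and violating the estimate could be normalised and adjoined.
  This replaces approximation of a Hilbert--Schmidt operator by finite rank ones.\<close>

lemma small_off_finite_family:
  assumes e: "e > 0"
  obtains H where "orthonormal H"
    "\<And>x. x \<in> ideal \<Longrightarrow> (\<And>h. h \<in> H \<Longrightarrow> b x h = 0) \<Longrightarrow> \<phi> (lmod (S x)) \<le> e * sqrt (Q x)"
proof -
  define good where "good H \<longleftrightarrow> orthonormal H \<and> (\<forall>h\<in>H. e \<le> \<phi> (lmod (S h)))" for H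
  obtain n :: nat where n: "(K * \<phi> u)\<^sup>2 / e\<^sup>2 < real n" using reals_Archimedean2 by blast
  have "card H < n" if "good H" for H
  proof -
    have "real (card H) * e\<^sup>2 \<le> (K * \<phi> u)\<^sup>2"
      using that e by (intro orthonormal_card_le[of H e]) (auto simp: good_def)
    then have "card H \<le> (K * \<phi> u)\<^sup>2 / e\<^sup>2" using e by (simp add: field_simps)
    then show ?thesis using n by simp
  qed
  moreover have "good {}" by (simp add: good_def orthonormal_def)
  ultimately obtain H where H: "good H" "\<And>H'. good H' \<Longrightarrow> card H' \<le> card H"
    using ex_has_greatest_nat[of good "{}" card n] by (metis less_imp_le)
  have o: "orthonormal H" and fH: "finite H" "H \<subseteq> ideal"
    using H(1) by (auto simp: good_def orthonormal_def)
  have "\<phi> (lmod (S x)) \<le> e * sqrt (Q x)" if x: "x \<in> ideal" and ort: "\<And>h. h \<in> H \<Longrightarrow> b x h = 0" for x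
  proof (rule ccontr)
    assume "\<not> ?thesis"
    then have gt: "\<phi> (lmod (S x)) > e * sqrt (Q x)" by simp
    have "Q x \<noteq> 0"
    proof
      assume "Q x = 0"
      then have "x = 0" using Q_eq_0_imp x by blast
      then show False using gt by (simp add: S.zero phi.zero Q_0)
    qed
    then have qx: "sqrt (Q x) > 0" using Q_nonneg[OF x] by simp
    define y where "y = (1 / sqrt (Q x)) *\<^sub>R x"
    have y: "y \<in> ideal" using x by (simp add: y_def V_intros)
    have Qy: "Q y = 1" using x qx Q_nonneg[OF x] by (simp add: y_def Q_scale power_divide)
    have by0: "b y h = 0" if "h \<in> H" for h
      using ort[OF that] x that fH by (auto simp: y_def b_scale)
    have bhy: "b h y = 0" if "h \<in> H" for h
      using by0[OF that] b_commute[of h y] y that fH by auto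
    have "y \<notin> H" using by0[of y] b_self[OF y] Qy by auto
    have "sqrt (Q x) *\<^sub>R S y = S x" using qx by (simp add: y_def S.scaleR)
    then have "lmod (S x) \<le> sqrt (Q x) *\<^sub>R lmod (S y)"
      using lmod_scaleR_le[of "sqrt (Q x)" "S y"] qx by simp
    from phi_mono[OF this] gt have "e * sqrt (Q x) < \<phi> (lmod (S y)) * sqrt (Q x)"
      by (simp add: phi.scaleR mult.commute)
    then have "e \<le> \<phi> (lmod (S y))" using qx by simp
    then have "good (insert y H)"
      using H(1) y Qy by0 bhy by (auto simp: good_def orthonormal_def)
    from H(2)[OF this] \<open>y \<notin> H\<close> fH show False by simp
  qed
  with o that show ?thesis by blast
qed

text \<open>\<open>B\<close> halves the Hilbert norm, for which the ideal need not be complete. One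
  application of \<open>B\<close> converts this decay into decay of the gauge norm, where
  \<open>ideal_limit\<close> applies.\<close>

lemma neumann:
  assumes B: "linear B"
    and q: "\<And>x. x \<in> ideal \<Longrightarrow> sqrt (Q (B x)) \<le> sqrt (Q x) / 2"
    and k: "\<And>x. x \<in> ideal \<Longrightarrow> lmod (B x) \<le> (K * sqrt (Q x)) *\<^sub>R u"
    and w: "w \<in> ideal"
  obtains x where "x \<in> ideal" "x - B x = w"
proof -
  have BI: "B x \<in> ideal" if "x \<in> ideal" for x using k[OF that] by (rule idealI)
  define D where "D n = (B ^^ n) w" for n
  have D0: "D 0 = w" and DS: "D (Suc n) = B (D n)" for n by (simp_all add: D_def)
  have DI: "D n \<in> ideal" for n by (induction n) (simp_all add: D0 DS w BI)
  have DQ: "sqrt (Q (D n)) \<le> sqrt (Q w) * (1/2) ^ n" for n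
  proof (induction n)
    case (Suc n) then show ?case using q[OF DI[of n]] by (simp add: DS)
  qed (simp add: D0)
  obtain cw where cw: "cw \<ge> 0" "lmod w \<le> cw *\<^sub>R u" using w by (rule idealE)
  \<comment> \<open>The first term of the series has only the gauge bound of w; every later one is
    bounded through its predecessor, and the factor 2 pays for the index shift.\<close>
  define c where "c = max cw (2 * K * sqrt (Q w))"
  have c0: "c \<ge> 0" using cw by (simp add: c_def)
  have Dl: "lmod (D n) \<le> (c * (1/2) ^ n) *\<^sub>R u" for n
  proof (cases n)
    case 0
    then show ?thesis using scaleR_le_scaleR[OF cw(2), of c] u_nonneg by (simp add: D0 c_def)
  next
    case (Suc m)
    have "lmod (D n) \<le> (K * sqrt (Q (D m))) *\<^sub>R u" unfolding Suc DS by (rule k[OF DI])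
    moreover have "K * sqrt (Q (D m)) \<le> c * (1/2) ^ n"
    proof -
      have "K * sqrt (Q (D m)) \<le> K * (sqrt (Q w) * (1/2) ^ m)"
        using DQ K_pos by (intro mult_left_mono) auto
      also have "\<dots> = (2 * K * sqrt (Q w)) * (1/2) ^ n" by (simp add: Suc)
      also have "\<dots> \<le> c * (1/2) ^ n" by (intro mult_right_mono) (auto simp: c_def)
      finally show ?thesis .
    qed
    ultimately show ?thesis using u_nonneg by (rule scaleR_le_scaleR)
  qed
  define X where "X n = (\<Sum>k<n. D k)" for n
  have XI: "X n \<in> ideal" for n unfolding X_def using DI by (intro subspace_sum[OF V])
  have XS: "X (Suc n) = w + B (X n)" for n
  proof (induction n)
    case 0 then show ?case by (simp add: X_def D0 linear_0[OF B])
  next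
    case (Suc n)
    have "X (Suc (Suc n)) = X (Suc n) + D (Suc n)" by (simp add: X_def)
    also have "\<dots> = w + (B (X n) + B (D n))" using Suc by (simp add: DS add.assoc)
    also have "\<dots> = w + B (X (Suc n))" by (simp add: X_def linear_add[OF B])
    finally show ?case .
  qed
  obtain x where x: "x \<in> ideal" "X \<longlonglongrightarrow> x" "\<And>n. lmod (x - X n) \<le> (2 * c * (1/2) ^ n) *\<^sub>R u"
    using ideal_limit[of X c] XI c0 Dl by (auto simp: X_def)
  \<comment> \<open>\<open>B\<close> is only linear, so its continuity along X is read off from
    \<open>k\<close> applied to the remainder, whose \<open>Q\<close> is small by its gauge
    bound.\<close>
  have Bn: "norm (B (X n) - B x) \<le> (2 * K * c * sqrt (\<phi> u) * norm u) * (1/2) ^ n" for n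
  proof -
    have z: "x - X n \<in> ideal" using x XI by (simp add: V_intros)
    have "Q (x - X n) \<le> (2 * c * (1/2) ^ n)\<^sup>2 * \<phi> u"
      using c0 by (intro Q_le_square x) auto
    then have "sqrt (Q (x - X n)) \<le> sqrt ((2 * c * (1/2) ^ n)\<^sup>2 * \<phi> u)" by (rule real_sqrt_le_mono)
    also have "\<dots> = 2 * c * (1/2) ^ n * sqrt (\<phi> u)" using c0 by (simp add: real_sqrt_mult)
    finally have s: "K * sqrt (Q (x - X n)) \<le> K * (2 * c * (1/2) ^ n * sqrt (\<phi> u))"
      using K_pos by (intro mult_left_mono) auto
    have "lmod (B (x - X n)) \<le> (K * (2 * c * (1/2) ^ n * sqrt (\<phi> u))) *\<^sub>R u"
      using k[OF z] s u_nonneg by (rule scaleR_le_scaleR)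
    from norm_le_of_lmod_le[OF this] have "norm (B (x - X n)) \<le> \<bar>K * (2 * c * (1/2) ^ n * sqrt (\<phi> u))\<bar> * norm u"
      by simp
    moreover have "0 \<le> K * (2 * c * (1/2) ^ n * sqrt (\<phi> u))"
      using K_pos c0 phi_u by simp
    ultimately show ?thesis by (simp add: linear_diff[OF B] norm_minus_commute mult_ac)
  qed
  have "(\<lambda>n. (2 * K * c * sqrt (\<phi> u) * norm u) * (1/2) ^ n) \<longlonglongrightarrow> 0"
    by (intro tendsto_mult_right_zero LIMSEQ_realpow_zero) auto
  with Bn have "(\<lambda>n. B (X n) - B x) \<longlonglongrightarrow> 0"
    by (rule Lim_null_comparison[OF always_eventually[OF allI]])
  then have "(\<lambda>n. B (X n)) \<longlonglongrightarrow> B x" by (simp add: LIM_zero_iff)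
  then have "(\<lambda>n. X (Suc n)) \<longlonglongrightarrow> w + B x" unfolding XS by (intro tendsto_intros)
  moreover have "(\<lambda>n. X (Suc n)) \<longlonglongrightarrow> x" using x(2) by (rule LIMSEQ_Suc)
  ultimately have "x = w + B x" by (rule LIMSEQ_unique[rotated])
  with x(1) that show ?thesis by (metis add_diff_cancel_right')
qed

text \<open>Composed with the projection off a finite family, S becomes a contraction in the Hilbert
  norm. Thus I - S is a finite rank perturbation of an operator that a Neumann series shows to be
  onto the ideal, and a dimension count does the rest.\<close>

lemma injective_imp_bij:
  assumes inj: "\<And>x. x = S x \<Longrightarrow> x = 0"
  shows "bij (\<lambda>x. x - S x)"
proof -
  \<comment> \<open>With this e, Q(B x) <= K sqrt(Q y) e sqrt(Q y) = Q(y)/4 for y = x - p x, which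
    halves the Hilbert norm.\<close>
  define e where "e = 1 / (4 * K)"
  have e: "e > 0" using K_pos by (simp add: e_def)
  obtain H where H: "orthonormal H"
    and small: "\<And>x. x \<in> ideal \<Longrightarrow> (\<And>h. h \<in> H \<Longrightarrow> b x h = 0) \<Longrightarrow> \<phi> (lmod (S x)) \<le> e * sqrt (Q x)"
    using small_off_finite_family[OF e] by blast
  have fH: "finite H" "H \<subseteq> ideal" using H by (auto simp: orthonormal_def)
  obtain p where p: "linear p" "\<And>x. x \<in> ideal \<Longrightarrow> p x = proj H x"
    using linear_extension_from_subspace[OF V, of "proj H"] proj_add[OF fH(2)] proj_scale[OF fH(2)]
    by blast
  define B where "B x = S (x - p x)" for x
  have B: "linear B"
    by (rule linearI) (simp_all add: B_def linear_add[OF p(1)] linear_scale[OF p(1)] S.add S.diff S.scaleR algebra_simps)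
  have py: "x - p x \<in> ideal" "Q (x - p x) \<le> Q x" if "x \<in> ideal" for x
    using that H fH by (simp_all add: p(2) Q_proj_complement_le proj_in_V V_intros)
  have kB: "lmod (B x) \<le> (K * sqrt (Q x)) *\<^sub>R u" if x: "x \<in> ideal" for x
    unfolding B_def
    by (rule scaleR_le_scaleR[OF S_dom_Q[OF py(1)[OF x]] _ u_nonneg])
      (use K_pos py(2)[OF x] in auto)
  have qB: "sqrt (Q (B x)) \<le> sqrt (Q x) / 2" if x: "x \<in> ideal" for x
  proof -
    let ?y = "x - p x"
    have "\<phi> (lmod (S ?y)) \<le> e * sqrt (Q ?y)"
      using x H by (intro small py) (simp_all add: p(2) b_proj_complement)
    then have "(K * sqrt (Q ?y)) * \<phi> (lmod (S ?y)) \<le> (K * sqrt (Q ?y)) * (e * sqrt (Q ?y))"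
      using K_pos Q_nonneg[OF py(1)[OF x]] by (intro mult_left_mono) auto
    also have "\<dots> = Q ?y / 4"
      using K_pos Q_nonneg[OF py(1)[OF x]] by (simp add: e_def)
    finally have "Q (B x) \<le> Q ?y / 4"
      using Q_le_phi[OF _ S_dom_Q[OF py(1)[OF x]]] K_pos Q_nonneg[OF py(1)[OF x]] by (simp add: B_def)
    then have "Q (B x) \<le> Q x / 4" using py(2)[OF x] by simp
    then have "sqrt (Q (B x)) \<le> sqrt (Q x / 4)" by (rule real_sqrt_le_mono)
    then show ?thesis by (simp add: real_sqrt_divide)
  qed
  define M where "M x = x - B x" for x
  define L where "L x = x - S x" for x
  have M: "linear M" using B by (auto simp: M_def linear_iff algebra_simps)
  have L: "linear L" by (auto simp: L_def linear_iff S.add S.scaleR algebra_simps)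
  have surjM: "\<exists>x\<in>ideal. M x = w" if "w \<in> ideal" for w
    using neumann[OF B qB kB that] unfolding M_def by blast
  have LM: "L x = M x - S (p x)" for x by (simp add: L_def M_def B_def S.diff)
  have Sp: "S (p x) \<in> span (S ` H)" if "x \<in> ideal" for x
  proof -
    have "S (p x) = (\<Sum>h\<in>H. b x h *\<^sub>R S h)" using that by (simp add: p(2) proj_def S.sum S.scaleR)
    then show ?thesis by (simp only:) (intro span_sum span_scale span_base imageI)
  qed
  \<comment> \<open>The \<open>k h\<close> lift the range of the finite rank term through M. On
    their span L takes values in the span of the \<open>S h\<close>, which is also the image under
    M, so injectivity of L gives surjectivity onto it.\<close>
  obtain k where k: "\<And>h. k h \<in> ideal" "\<And>h. M (k h) = S h"
    using surjM[OF S_ideal] by metis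
  have "M ` span (k ` H) = span (S ` H)"
    using k(2) by (simp add: linear_span_image[OF M, symmetric] image_image)
  moreover have spI: "span (k ` H) \<subseteq> ideal" using k(1) V by (intro span_minimal) auto
  moreover have "L ` span (k ` H) \<subseteq> M ` span (k ` H)"
  proof safe
    fix y assume y: "y \<in> span (k ` H)"
    have "M y \<in> M ` span (k ` H)" using y by blast
    then show "L y \<in> M ` span (k ` H)"
      unfolding LM \<open>M ` span (k ` H) = span (S ` H)\<close>
      using Sp spI y by (blast intro: span_diff)
  qed
  ultimately have fin: "span (S ` H) \<subseteq> L ` span (k ` H)"
    using finite_dim_injective_imp_surjective[OF L M, of "k ` H"] fH inj by (auto simp: L_def)
  have surjL: "\<exists>x. L x = w" if w: "w \<in> ideal" for w
  proof -
    obtain x where x: "x \<in> ideal" "M x = w" using surjM[OF w] by blast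
    obtain y where "L y = S (p x)" using Sp[OF x(1)] fin by (metis imageE subsetD)
    then have "L (x + y) = w" using x LM[of x] by (simp add: linear_add[OF L])
    then show ?thesis by blast
  qed
  \<comment> \<open>S maps the whole space into the ideal: a solution of L f = S g, added to g,
    solves the equation with right-hand side g.\<close>
  have "surj L"
    unfolding surj_def
  proof
    fix g
    obtain f where "L f = S g" using surjL[OF S_ideal] by blast
    then have "L (g + f) = g" by (simp add: L_def S.add algebra_simps)
    then show "\<exists>x. g = L x" by metis
  qed
  moreover have "inj L"
    using inj by (subst linear_injective_0[OF L]) (auto simp: L_def)
  ultimately show ?thesis unfolding bij_def L_def by blast
qed

end

subsection \<open>Domination is uniform\<close>

lemma uniform_order_bound:
  fixes T :: "'a::banach \<Rightarrow> 'b::banach_lattice"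
  assumes T: "bounded_linear T" and u: "0 \<le> u"
    and dom: "\<And>f. \<exists>c. lmod (T f) \<le> c *\<^sub>R u"
  obtains K where "K > 0" "\<And>f. lmod (T f) \<le> (K * norm f) *\<^sub>R u"
proof -
  interpret T: bounded_linear T by fact
  let ?C = "\<lambda>n::nat. {f. lmod (T f) \<le> real n *\<^sub>R u}"
  obtain n \<delta> where \<delta>: "\<delta> > 0" and n: "\<And>f. norm f < \<delta> \<Longrightarrow> f \<in> ?C n"
  proof (rule Baire_symmetric_convex[of ?C])
    fix n
    have "?C n = T -` {x. lmod x \<le> real n *\<^sub>R u}" by auto
    then show "closed (?C n)"
      by (simp only:) (intro closed_vimage closed_lmod_le T.continuous_on continuous_on_id)
  next
    show "(\<Union>n. ?C n) = UNIV"
    proof safe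
      fix f
      obtain c where c: "lmod (T f) \<le> c *\<^sub>R u" using dom by blast
      obtain n where "c \<le> real n" using real_arch_simple by blast
      with c u have "f \<in> ?C n" by (auto elim: scaleR_le_scaleR)
      then show "f \<in> (\<Union>n. ?C n)" by blast
    qed simp
  next
    fix n x y assume "x \<in> ?C n" "y \<in> ?C n"
    then have "lmod (T x - T y) \<le> real n *\<^sub>R u + real n *\<^sub>R u"
      using order_trans[OF lmod_triangle_minus add_mono] by blast
    from scaleR_left_mono[OF this, of "1/2"]
    have "(1/2) *\<^sub>R lmod (T x - T y) \<le> real n *\<^sub>R u" by (simp flip: scaleR_2)
    then show "(1/2) *\<^sub>R (x - y) \<in> ?C n"
      using lmod_scaleR_le[of "1/2" "T x - T y"] by (simp add: T.scaleR T.diff)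
  qed blast
  show ?thesis
  proof
    \<comment> \<open>The summand 1 keeps the constant positive even for n = 0.\<close>
    show "2 * real n / \<delta> + 1 > 0" using \<delta> by (simp add: add_nonneg_pos)
    fix f
    show "lmod (T f) \<le> ((2 * real n / \<delta> + 1) * norm f) *\<^sub>R u"
    proof (cases "f = 0")
      case True then show ?thesis by (simp add: T.zero)
    next
      case False
      define t where "t = 2 * norm f / \<delta>"
      have t: "t > 0" using False \<delta> by (simp add: t_def)
      have "norm ((1 / t) *\<^sub>R f) < \<delta>" using False \<delta> by (simp add: t_def)
      then have "lmod (T ((1 / t) *\<^sub>R f)) \<le> real n *\<^sub>R u" using n by blast
      from scaleR_left_mono[OF this, of t] t
      have "t *\<^sub>R lmod (T ((1 / t) *\<^sub>R f)) \<le> (t * real n) *\<^sub>R u" by simp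
      moreover have "lmod (T f) \<le> t *\<^sub>R lmod (T ((1 / t) *\<^sub>R f))"
        using lmod_scaleR_le[of t "T ((1 / t) *\<^sub>R f)"] t by (simp add: T.scaleR)
      ultimately have "lmod (T f) \<le> (t * real n) *\<^sub>R u" by (rule order_trans[rotated])
      moreover have "t * real n \<le> (2 * real n / \<delta> + 1) * norm f"
        by (simp add: t_def algebra_simps)
      ultimately show ?thesis using u by (rule scaleR_le_scaleR)
    qed
  qed
qed

text \<open>Baire is applied in the Banach space of functionals, and a functional norming
  \<open>T f\<close> converts the uniform bound into one for the norm. With T a resolvent power and
  q f = \<phi>(|f|), domination of the adjoint becomes a statement about the operator
  itself.\<close>

lemma uniform_functional_bound:
  fixes T :: "'a \<Rightarrow> 'b::real_normed_vector" and q :: "'a \<Rightarrow> real"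
  assumes dom: "\<And>y::'b \<Rightarrow> real. bounded_linear y \<Longrightarrow> \<exists>c. \<forall>f. \<bar>y (T f)\<bar> \<le> c * q f"
    and q: "\<And>f. 0 \<le> q f"
  obtains K where "K > 0" "\<And>f. norm (T f) \<le> K * q f"
proof -
  let ?C = "\<lambda>n::nat. {y::'b \<Rightarrow>\<^sub>L real. \<forall>f. \<bar>blinfun_apply y (T f)\<bar> \<le> real n * q f}"
  obtain n \<delta> where \<delta>: "\<delta> > 0" and n: "\<And>y. norm y < \<delta> \<Longrightarrow> y \<in> ?C n"
  proof (rule Baire_symmetric_convex[of ?C])
    fix n
    have "?C n = (\<Inter>f. {y. \<bar>blinfun_apply y (T f)\<bar> \<le> real n * q f})" by auto
    moreover have "closed {y::'b \<Rightarrow>\<^sub>L real. \<bar>blinfun_apply y (T f)\<bar> \<le> real n * q f}" for f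
      by (intro closed_Collect_le continuous_intros)
    ultimately show "closed (?C n)" by (simp only:) (intro closed_INT ballI)
  next
    show "(\<Union>n. ?C n) = UNIV"
    proof safe
      fix y :: "'b \<Rightarrow>\<^sub>L real"
      obtain c where c: "\<And>f. \<bar>blinfun_apply y (T f)\<bar> \<le> c * q f"
        using dom[OF blinfun.bounded_linear_right[of y]] by blast
      obtain n where "c \<le> real n" using real_arch_simple by blast
      then have "c * q f \<le> real n * q f" for f using q by (intro mult_right_mono)
      with c have "y \<in> ?C n" using order_trans by blast
      then show "y \<in> (\<Union>n. ?C n)" by blast
    qed simp
  next
    fix n x y assume xy: "x \<in> ?C n" "y \<in> ?C n"
    have "\<bar>blinfun_apply ((1/2) *\<^sub>R (x - y)) (T f)\<bar> \<le> real n * q f" for f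
    proof -
      have "\<bar>blinfun_apply x (T f) - blinfun_apply y (T f)\<bar>
        \<le> \<bar>blinfun_apply x (T f)\<bar> + \<bar>blinfun_apply y (T f)\<bar>" by (rule abs_triangle_ineq4)
      also have "\<dots> \<le> real n * q f + real n * q f" using xy by (intro add_mono) auto
      finally show ?thesis by (simp add: blinfun.scaleR_left blinfun.diff_left abs_mult)
    qed
    then show "(1/2) *\<^sub>R (x - y) \<in> ?C n" by simp
  qed blast
  show ?thesis
  proof
    show "2 * real n / \<delta> + 1 > 0" using \<delta> by (simp add: add_nonneg_pos)
    fix f
    obtain y :: "'b \<Rightarrow> real" where y: "bounded_linear y" "\<And>x. \<bar>y x\<bar> \<le> norm x" "y (T f) = norm (T f)"
      using norming_functional[of "T f"] by blast
    let ?y = "(\<delta> / 2) *\<^sub>R Blinfun y"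
    have "norm (Blinfun y) \<le> 1"
      using y by (intro norm_blinfun_bound) (simp_all add: bounded_linear_Blinfun_apply)
    then have "norm ?y < \<delta>" using \<delta> mult_left_mono[of "norm (Blinfun y)" 1 "\<delta> / 2"] by simp
    then have "\<bar>blinfun_apply ?y (T f)\<bar> \<le> real n * q f" using n by blast
    then have "\<delta> / 2 * norm (T f) \<le> real n * q f"
      using y \<delta> by (simp add: blinfun.scaleR_left bounded_linear_Blinfun_apply abs_mult)
    then have "norm (T f) \<le> 2 * real n / \<delta> * q f" using \<delta> by (simp add: field_simps)
    also have "\<dots> \<le> (2 * real n / \<delta> + 1) * q f" using q by (simp add: algebra_simps)
    finally show "norm (T f) \<le> (2 * real n / \<delta> + 1) * q f" .
  qed
qed

subsection \<open>Resolvents of real operators\<close>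

text \<open>A relational resolvent: naming the two-sided inverse \<open>R\<close> keeps definite
  descriptions out of the real theory.\<close>

definition resolves :: "'a::real_normed_vector set \<Rightarrow> ('a \<Rightarrow> 'a) \<Rightarrow> real \<Rightarrow> ('a \<Rightarrow> 'a) \<Rightarrow> bool" where
  "resolves D A \<mu> R \<longleftrightarrow> bounded_linear R \<and> (\<forall>y. R y \<in> D \<and> \<mu> *\<^sub>R R y - A (R y) = y) \<and>
     (\<forall>x\<in>D. R (\<mu> *\<^sub>R x - A x) = x)"

lemma resolvesD:
  assumes "resolves D A \<mu> R"
  shows "bounded_linear R" "R y \<in> D" "A (R y) = \<mu> *\<^sub>R R y - y" "x \<in> D \<Longrightarrow> R (A x) = \<mu> *\<^sub>R R x - x"
proof -
  show bl: "bounded_linear R" and "R y \<in> D" using assms by (auto simp: resolves_def)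
  show "A (R y) = \<mu> *\<^sub>R R y - y" using assms by (simp add: resolves_def algebra_simps)
  assume "x \<in> D"
  then have "R (\<mu> *\<^sub>R x - A x) = x" using assms by (simp add: resolves_def)
  then show "R (A x) = \<mu> *\<^sub>R R x - x"
    using bl by (simp add: linear_diff linear_scale bounded_linear.linear algebra_simps)
qed

lemma resolvent_identity:
  assumes R0: "resolves D A \<mu>0 R0" and R1: "resolves D A \<mu>1 R1"
  shows "R1 f = R0 f - (\<mu>1 - \<mu>0) *\<^sub>R R0 (R1 f)"
proof -
  have "R0 (A (R1 f)) = \<mu>0 *\<^sub>R R0 (R1 f) - R1 f"
    using resolvesD(4)[OF R0 resolvesD(2)[OF R1]] .
  moreover have "R0 (A (R1 f)) = \<mu>1 *\<^sub>R R0 (R1 f) - R0 f"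
    using resolvesD(1)[OF R0] by (simp add: resolvesD(3)[OF R1] linear_diff linear_scale bounded_linear.linear)
  ultimately show ?thesis by (simp add: algebra_simps)
qed

lemma resolvent_commute:
  assumes R0: "resolves D A \<mu>0 R0" and R1: "resolves D A \<mu>1 R1"
  shows "R0 (R1 f) = R1 (R0 f)"
proof (cases "\<mu>0 = \<mu>1")
  case True
  then have "R1 f = R0 f" for f using resolvent_identity[OF R0 R1] by simp
  then show ?thesis by simp
next
  case False
  have "(\<mu>1 - \<mu>0) *\<^sub>R R0 (R1 f) = (\<mu>1 - \<mu>0) *\<^sub>R R1 (R0 f)"
  proof -
    have "(\<mu>1 - \<mu>0) *\<^sub>R R0 (R1 f) = R0 f - R1 f"
      using resolvent_identity[OF R0 R1, of f] by (metis add_diff_cancel_left' diff_add_cancel)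
    moreover have "(\<mu>0 - \<mu>1) *\<^sub>R R1 (R0 f) = R1 f - R0 f"
      using resolvent_identity[OF R1 R0, of f] by (metis add_diff_cancel_left' diff_add_cancel)
    ultimately show ?thesis by (metis minus_diff_eq scaleR_minus_left)
  qed
  then show ?thesis using False by simp
qed

lemma bounded_linear_funpow:
  fixes R :: "'a::real_normed_vector \<Rightarrow> 'a"
  assumes "bounded_linear R" shows "bounded_linear (R ^^ n)"
  by (induction n) (auto simp: id_def o_def intro: bounded_linear_compose[OF assms] bounded_linear_ident)

section \<open>Upper bounds from a negative resolvent\<close>

context weighted_ideal
begin

text \<open>With P = - R0 the resolvent identity reads R1 = - P + (\<mu>1 - \<mu>0) P R1, so that
  R1 f \<le> ((\<mu>1 - \<mu>0) P)^n (R1 f) for f \<ge> 0; for n = m1 + m2 the right hand side is dominated.\<close>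
lemma negative_resolvent_imp_upper_bound:
  assumes R0: "resolves D A \<mu>0 R0" and R1: "resolves D A \<mu>1 R1" and less: "\<mu>0 < \<mu>1"
    and neg: "\<And>f. 0 \<le> f \<Longrightarrow> R0 f \<le> 0"
    and dom1: "\<And>f. \<exists>c. lmod ((R0 ^^ m1) f) \<le> c *\<^sub>R u"
    and dom2: "\<And>y::'a \<Rightarrow> real. bounded_linear y \<Longrightarrow> \<exists>c. \<forall>f. \<bar>y ((R0 ^^ m2) f)\<bar> \<le> c * \<phi> (lmod f)"
  obtains K where "K > 0" "\<And>f. 0 \<le> f \<Longrightarrow> R1 f \<le> (K * \<phi> f) *\<^sub>R u"
proof -
  interpret R0: bounded_linear R0 using R0 by (rule resolvesD)
  interpret R1: bounded_linear R1 using R1 by (rule resolvesD)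
  define d where "d = \<mu>1 - \<mu>0"
  have d: "d > 0" using less by (simp add: d_def)
  obtain K1 where K1: "K1 > 0" "\<And>f. lmod ((R0 ^^ m1) f) \<le> (K1 * norm f) *\<^sub>R u"
    using uniform_order_bound[OF bounded_linear_funpow[OF R0.bounded_linear_axioms] u_nonneg dom1] by blast
  obtain K2 where K2: "K2 > 0" "\<And>f. norm ((R0 ^^ m2) f) \<le> K2 * \<phi> (lmod f)"
    using uniform_functional_bound[of "R0 ^^ m2" "\<lambda>f. \<phi> (lmod f)"] dom2 phi_nonneg lmod_nonneg by metis
  obtain K3 where K3: "K3 > 0" "\<And>f. norm (R1 f) \<le> norm f * K3" using R1.pos_bounded by blast
  have anti: "R0 y \<le> R0 x" if "x \<le> y" for x y
    using neg[of "y - x"] that by (simp add: R0.diff)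
  \<comment> \<open>Each round drops the negative term \<open>R0 f\<close> and inserts the previous
    bound through the antitone \<open>R0\<close>; the sign in (-d)^n reflects that - R0 is the
    positive operator.\<close>
  have iterate: "R1 f \<le> ((- d) ^ n) *\<^sub>R (R0 ^^ n) (R1 f)" if f: "0 \<le> f" for f n
  proof (induction n)
    case (Suc n)
    have "R1 f = R0 f - d *\<^sub>R R0 (R1 f)" unfolding d_def by (rule resolvent_identity[OF R0 R1])
    also have "\<dots> \<le> 0 - d *\<^sub>R R0 (R1 f)" by (intro diff_right_mono neg f)
    also have "\<dots> \<le> 0 - d *\<^sub>R R0 (((- d) ^ n) *\<^sub>R (R0 ^^ n) (R1 f))"
      using anti[OF Suc.IH] d by (intro diff_left_mono scaleR_left_mono) auto
    also have "\<dots> = ((- d) ^ Suc n) *\<^sub>R (R0 ^^ Suc n) (R1 f)" by (simp add: R0.scaleR)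
    finally show ?case .
  qed simp
  have comm: "(R0 ^^ n) (R1 f) = R1 ((R0 ^^ n) f)" for n f
    by (induction n) (simp_all add: resolvent_commute[OF R0 R1])
  define K where "K = d ^ (m1 + m2) * K1 * K3 * K2"
  show ?thesis
  proof
    show "K > 0" using d K1 K2 K3 by (simp add: K_def)
    fix f :: 'a assume f: "0 \<le> f"
    let ?h = "(R0 ^^ (m1 + m2)) (R1 f)"
    \<comment> \<open>The order of the factors matters: the inner power turns \<phi>(f) into a norm
      bound, R1 keeps it, and the outer power turns it into a multiple of u.\<close>
    have "?h = (R0 ^^ m1) (R1 ((R0 ^^ m2) f))" by (simp add: funpow_add comm)
    then have "lmod ?h \<le> (K1 * norm (R1 ((R0 ^^ m2) f))) *\<^sub>R u" using K1(2) by simp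
    moreover have "K1 * norm (R1 ((R0 ^^ m2) f)) \<le> K1 * (K2 * \<phi> f * K3)"
    proof -
      have "norm (R1 ((R0 ^^ m2) f)) \<le> norm ((R0 ^^ m2) f) * K3" by (rule K3)
      also have "\<dots> \<le> K2 * \<phi> f * K3" using K2(2)[of f] f K3 by (intro mult_right_mono) auto
      finally show ?thesis using K1 by simp
    qed
    ultimately have h: "lmod ?h \<le> (K1 * (K2 * \<phi> f * K3)) *\<^sub>R u" using u_nonneg by (rule scaleR_le_scaleR)
    have "R1 f \<le> ((- d) ^ (m1 + m2)) *\<^sub>R ?h" by (rule iterate[OF f])
    also have "\<dots> \<le> lmod (((- d) ^ (m1 + m2)) *\<^sub>R ?h)" by (rule lmod_upper)
    also have "\<dots> \<le> \<bar>(- d) ^ (m1 + m2)\<bar> *\<^sub>R lmod ?h" by (rule lmod_scaleR_le)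
    also have "\<dots> = d ^ (m1 + m2) *\<^sub>R lmod ?h" using d by (simp add: power_abs)
    also have "\<dots> \<le> d ^ (m1 + m2) *\<^sub>R ((K1 * (K2 * \<phi> f * K3)) *\<^sub>R u)"
      using h d by (intro scaleR_left_mono) auto
    also have "\<dots> = (K * \<phi> f) *\<^sub>R u" by (simp add: K_def mult_ac)
    finally show "R1 f \<le> (K * \<phi> f) *\<^sub>R u" .
  qed
qed

text \<open>Positive and negative part are estimated separately; additivity of \<phi> on them
  restores \<phi>(|f|).\<close>

lemma two_sided_bound_imp_dominated:
  assumes R: "bounded_linear R"
    and lo: "\<And>f. 0 \<le> f \<Longrightarrow> - ((c * \<phi> f) *\<^sub>R u) \<le> R f"
    and up: "\<And>f. 0 \<le> f \<Longrightarrow> R f \<le> (c * \<phi> f) *\<^sub>R u"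
  shows "lmod (R f) \<le> (c * \<phi> (lmod f)) *\<^sub>R u"
proof -
  interpret R: bounded_linear R by fact
  obtain p n where pn: "0 \<le> p" "0 \<le> n" "f = p - n" "lmod f = p + n" by (rule nonneg_parts)
  have "lmod (R g) \<le> (c * \<phi> g) *\<^sub>R u" if "0 \<le> g" for g
    unfolding lmod_le_iff using up[OF that] lo[OF that] by (simp add: minus_le_iff)
  then have "lmod (R p - R n) \<le> (c * \<phi> p) *\<^sub>R u + (c * \<phi> n) *\<^sub>R u"
    using pn order_trans[OF lmod_triangle_minus add_mono] by blast
  also have "\<dots> = (c * \<phi> (lmod f)) *\<^sub>R u"
    by (simp add: pn(4) phi.add distrib_left scaleR_add_left)
  finally show ?thesis by (simp add: pn(3) R.diff)
qed

end

text \<open>The equation is the fixed point problem x = Z(y + \<eta> T x), contracting by 1/2 for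
  \<eta> <= \<eta>0. What matters later is that the bound on the inverse does not depend on
  \<eta>.\<close>

lemma perturbed_inverse:
  fixes M T Z :: "'a::banach \<Rightarrow> 'a"
  assumes M: "bounded_linear M" and T: "bounded_linear T" and Z: "bounded_linear Z"
    and ZM: "\<And>x. Z (M x) = x" and MZ: "\<And>x. M (Z x) = x"
  obtains \<eta>0 K where "\<eta>0 > 0" "K > 0"
    "\<And>\<eta>. 0 \<le> \<eta> \<Longrightarrow> \<eta> \<le> \<eta>0 \<Longrightarrow> \<exists>Y. bounded_linear Y \<and> (\<forall>x. Y (M x - \<eta> *\<^sub>R T x) = x) \<and>
       (\<forall>y. M (Y y) - \<eta> *\<^sub>R T (Y y) = y) \<and> (\<forall>y. norm (Y y) \<le> K * norm y)"
proof -
  interpret M: bounded_linear M by fact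
  interpret T: bounded_linear T by fact
  interpret Z: bounded_linear Z by fact
  obtain kz where kz: "kz > 0" "\<And>x. norm (Z x) \<le> norm x * kz" using Z.pos_bounded by blast
  obtain kt where kt: "kt > 0" "\<And>x. norm (T x) \<le> norm x * kt" using T.pos_bounded by blast
  define \<eta>0 where "\<eta>0 = 1 / (2 * kz * kt)"
  show ?thesis
  proof
    show "\<eta>0 > 0" "2 * kz > 0" using kz kt by (simp_all add: \<eta>0_def)
    fix \<eta> :: real assume \<eta>: "0 \<le> \<eta>" "\<eta> \<le> \<eta>0"
    have half: "norm (Z (\<eta> *\<^sub>R T x)) \<le> norm x / 2" for x
    proof -
      have "norm (Z (\<eta> *\<^sub>R T x)) \<le> \<eta> * norm (T x) * kz" using kz(2)[of "\<eta> *\<^sub>R T x"] \<eta> by simp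
      also have "\<dots> \<le> \<eta>0 * (norm x * kt) * kz"
        using \<eta> kt(2)[of x] kz by (intro mult_right_mono mult_mono) auto
      also have "\<dots> = norm x / 2" using kz kt by (simp add: \<eta>0_def)
      finally show ?thesis .
    qed
    have ex: "\<exists>!x. Z (y + \<eta> *\<^sub>R T x) = x" for y
    proof (rule banach_fix_type[where c = "1/2"])
      show "\<forall>x x'. dist (Z (y + \<eta> *\<^sub>R T x)) (Z (y + \<eta> *\<^sub>R T x')) \<le> 1/2 * dist x x'"
      proof (intro allI)
        fix x x'
        have "Z (y + \<eta> *\<^sub>R T x) - Z (y + \<eta> *\<^sub>R T x') = Z (\<eta> *\<^sub>R T (x - x'))"
          by (simp add: T.diff scaleR_diff_right flip: Z.diff)
        then show "dist (Z (y + \<eta> *\<^sub>R T x)) (Z (y + \<eta> *\<^sub>R T x')) \<le> 1/2 * dist x x'"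
          using half[of "x - x'"] by (simp add: dist_norm)
      qed
    qed auto
    have fix_iff: "Z (y + \<eta> *\<^sub>R T x) = x \<longleftrightarrow> M x - \<eta> *\<^sub>R T x = y" for x y
      by (metis MZ ZM add_diff_cancel_right' diff_add_cancel)
    define Y where "Y y = (THE x. M x - \<eta> *\<^sub>R T x = y)" for y
    have Y: "M (Y y) - \<eta> *\<^sub>R T (Y y) = y" for y
      using theI'[OF ex[of y, unfolded fix_iff]] by (simp add: Y_def)
    have Y': "Y (M x - \<eta> *\<^sub>R T x) = x" for x
      unfolding Y_def using ex[of "M x - \<eta> *\<^sub>R T x", unfolded fix_iff] by (intro the1_equality) auto
    have bound: "norm (Y y) \<le> 2 * kz * norm y" for y
    proof -
      have "Y y = Z y + Z (\<eta> *\<^sub>R T (Y y))" using Y[of y] fix_iff by (metis Z.add)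
      then have "norm (Y y) \<le> norm (Z y) + norm (Z (\<eta> *\<^sub>R T (Y y)))" by (metis norm_triangle_ineq)
      then show ?thesis using half[of "Y y"] kz(2)[of y] by (simp add: mult_ac)
    qed
    have "bounded_linear Y"
    proof (rule bounded_linear_intro)
      show "Y (x + y) = Y x + Y y" for x y
        using Y'[of "Y x + Y y"] Y[of x] Y[of y]
        by (simp add: M.add T.add scaleR_add_right add_diff_add)
      show "Y (r *\<^sub>R x) = r *\<^sub>R Y x" for r x
        using Y'[of "r *\<^sub>R Y x"] Y[of x]
        by (simp add: M.scaleR T.scaleR mult.commute flip: scaleR_diff_right)
          (metis scaleR_diff_right scaleR_scaleR mult.commute)
      show "norm (Y x) \<le> norm x * (2 * kz)" for x using bound[of x] by (simp add: mult_ac)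
    qed
    with Y Y' bound show "\<exists>Y. bounded_linear Y \<and> (\<forall>x. Y (M x - \<eta> *\<^sub>R T x) = x) \<and>
       (\<forall>y. M (Y y) - \<eta> *\<^sub>R T (Y y) = y) \<and> (\<forall>y. norm (Y y) \<le> 2 * kz * norm y)" by blast
  qed
qed

section \<open>The resolvent to the left of the eigenvalue\<close>

context weighted_ideal
begin

lemma phi_lmod_bound:
  obtains k where "k > 0" "\<And>f. \<phi> (lmod f) \<le> k * norm f"
proof -
  obtain k where k: "k > 0" "\<And>f. norm (\<phi> f) \<le> norm f * k" using phi.pos_bounded by blast
  have "\<phi> (lmod f) \<le> k * norm f" for f
  proof -
    have "norm (lmod f) \<le> norm f"
      by (rule lattice_norm) (simp only: lmod_def[symmetric] lmod_of_nonneg lmod_nonneg order_refl)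
    then have "norm (lmod f) * k \<le> norm f * k" using k by (intro mult_right_mono) auto
    then show ?thesis using k(2)[of "lmod f"] by (simp add: mult.commute)
  qed
  with k that show ?thesis by blast
qed

text \<open>\<open>T\<close> = d R1 fixes v and leaves \<psi> invariant, and \<open>P\<close> is the
  projection built from this pair. Once I - T + P is invertible, the part of the resolvent on the
  kernel of \<psi> stays bounded near lam, while the part along v is a pole whose sign to the left
  of lam is negative.\<close>

lemma dominated_resolvent_imp_negative_left:
  assumes D: "subspace D"
    and A_add: "\<And>x y. x \<in> D \<Longrightarrow> y \<in> D \<Longrightarrow> A (x + y) = A x + A y"
    and A_scale: "\<And>c x. x \<in> D \<Longrightarrow> A (c *\<^sub>R x) = c *\<^sub>R A x"
    and R1: "resolves D A \<mu>1 R1" and less: "lam < \<mu>1"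
    and C: "C > 0" and dom: "\<And>f. lmod (R1 f) \<le> (C * \<phi> (lmod f)) *\<^sub>R u"
    and v: "v \<in> D" "A v = lam *\<^sub>R v"
    and simple: "\<And>x. x \<in> D \<Longrightarrow> A x = lam *\<^sub>R x \<Longrightarrow> \<exists>c. x = c *\<^sub>R v"
    and a: "a > 0" "a *\<^sub>R u \<le> v" and v_le: "v \<le> a' *\<^sub>R u"
    and psi: "bounded_linear \<psi>" "\<And>x. x \<in> D \<Longrightarrow> \<psi> (A x) = lam * \<psi> x"
    and psi_lo: "b0 > 0" "\<And>f. 0 \<le> f \<Longrightarrow> b0 * \<phi> f \<le> \<psi> f"
    and psi_up: "b' > 0" "\<And>f. \<bar>\<psi> f\<bar> \<le> b' * \<phi> (lmod f)"
  obtains \<epsilon> where "\<epsilon> > 0"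
    "\<And>\<mu>. lam - \<epsilon> < \<mu> \<Longrightarrow> \<mu> < lam \<Longrightarrow>
       \<exists>R. resolves D A \<mu> R \<and> (\<forall>f\<ge>0. R f \<le> - (\<phi> f *\<^sub>R u))"
proof -
  interpret R1: bounded_linear R1 using R1 by (rule resolvesD)
  interpret psi: bounded_linear \<psi> by fact
  define d where "d = \<mu>1 - lam"
  have d: "d > 0" using less by (simp add: d_def)
  have v0: "0 \<le> v" using a u_nonneg order_trans[OF scaleR_nonneg_nonneg[of a u]] by simp
  have phi_v: "0 < \<phi> v"
  proof -
    have "a * \<phi> u \<le> \<phi> v" using phi_mono[OF a(2)] by (simp add: phi.scaleR)
    then show ?thesis using a(1) phi_u by (meson less_le_trans mult_pos_pos)
  qed
  \<comment> \<open>As \<psi> annihilates the range of lam - A, its being positive at v excludes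
    generalised eigenvectors above v.\<close>
  define s where "s = \<psi> v"
  have s: "s > 0"
    using psi_lo(2)[OF v0] mult_pos_pos[OF psi_lo(1) phi_v] by (simp add: s_def)
  define T where "T f = d *\<^sub>R R1 f" for f
  define P where "P f = (\<psi> f / s) *\<^sub>R v" for f
  have T: "bounded_linear T" unfolding T_def by (intro bounded_linear_intros R1.bounded_linear_axioms)
  have P: "bounded_linear P"
    unfolding P_def
    by (rule bounded_linear_scaleR_const) (intro bounded_linear_divide[THEN bounded_linear_compose] psi)
  interpret T: bounded_linear T by (rule T)
  interpret P: bounded_linear P by (rule P)
  have "R1 (A v) = \<mu>1 *\<^sub>R R1 v - v" using resolvesD(4)[OF R1 v(1)] .
  then have Tv: "T v = v" by (simp add: v(2) R1.scaleR T_def d_def scaleR_diff_left)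
  have psiT: "\<psi> (T f) = \<psi> f" for f
  proof -
    have "lam * \<psi> (R1 f) = \<mu>1 * \<psi> (R1 f) - \<psi> f"
      using psi(2)[OF resolvesD(2)[OF R1, of f]] by (simp add: resolvesD(3)[OF R1] psi.diff psi.scaleR)
    then show ?thesis unfolding T_def psi.scaleR d_def by (simp add: left_diff_distrib)
  qed
  have psiP: "\<psi> (P f) = \<psi> f" for f using s by (simp add: P_def psi.scaleR s_def)
  have P_lmod: "lmod (P f) \<le> (b' * \<phi> (lmod f) / s) *\<^sub>R v" for f
  proof -
    have "lmod (P f) \<le> \<bar>\<psi> f / s\<bar> *\<^sub>R v"
      unfolding P_def using lmod_scaleR_le[of "\<psi> f / s" v] v0 by simp
    moreover have "\<bar>\<psi> f / s\<bar> \<le> b' * \<phi> (lmod f) / s"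
      using psi_up(2)[of f] s by (simp add: abs_div_pos divide_right_mono flip: abs_div_pos)
    ultimately show ?thesis using v0 by (rule scaleR_le_scaleR)
  qed
  define S where "S f = T f - P f" for f
  \<comment> \<open>The first summand comes from T, the second from P; the absolute value is taken
    because the sign of a' is not given.\<close>
  define C' where "C' = d * C + b' / s * \<bar>a'\<bar>"
  interpret S: dominated_operator u \<phi> S C'
  proof (intro dominated_operator.intro dominated_operator_axioms.intro)
    show "weighted_ideal u \<phi>" by (rule weighted_ideal_axioms)
    show "bounded_linear S" unfolding S_def by (intro bounded_linear_sub T P)
    show "0 < C'" using d C psi_up(1) s by (simp add: C'_def add_pos_nonneg)
    fix f
    have ph: "0 \<le> \<phi> (lmod f)" by (simp add: phi_nonneg)
    have "lmod (T f) \<le> d *\<^sub>R lmod (R1 f)" unfolding T_def using lmod_scaleR_le[of d "R1 f"] d by simp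
    also have "\<dots> \<le> d *\<^sub>R ((C * \<phi> (lmod f)) *\<^sub>R u)" using dom d by (intro scaleR_left_mono) auto
    finally have 1: "lmod (T f) \<le> (d * C * \<phi> (lmod f)) *\<^sub>R u" by (simp add: mult.assoc)
    have "v \<le> \<bar>a'\<bar> *\<^sub>R u" using v_le u_nonneg by (auto elim: scaleR_le_scaleR)
    then have "(b' * \<phi> (lmod f) / s) *\<^sub>R v \<le> (b' * \<phi> (lmod f) / s) *\<^sub>R (\<bar>a'\<bar> *\<^sub>R u)"
      using psi_up(1) ph s by (intro scaleR_left_mono) auto
    with P_lmod[of f] have "lmod (P f) \<le> (b' * \<phi> (lmod f) / s) *\<^sub>R (\<bar>a'\<bar> *\<^sub>R u)" by (rule order_trans)
    then have 2: "lmod (P f) \<le> (b' / s * \<bar>a'\<bar> * \<phi> (lmod f)) *\<^sub>R u" by (simp add: mult_ac)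
    have "lmod (S f) \<le> (d * C * \<phi> (lmod f)) *\<^sub>R u + (b' / s * \<bar>a'\<bar> * \<phi> (lmod f)) *\<^sub>R u"
      unfolding S_def by (rule order_trans[OF lmod_triangle_minus add_mono[OF 1 2]])
    then show "lmod (S f) \<le> (C' * \<phi> (lmod f)) *\<^sub>R u"
      by (simp add: C'_def distrib_right scaleR_add_left)
  qed
  \<comment> \<open>Subtracting P removes the eigenvector: x = S x forces \<psi> x = 0, so x = T x
    lies in the eigenspace of lam and is a multiple of v annihilated by \<psi>, hence 0.\<close>
  have inj: "x = 0" if x: "x = S x" for x
  proof -
    have "\<psi> x = 0" using arg_cong[OF x, of \<psi>] by (simp add: S_def psi.diff psiT psiP)
    then have xT: "x = d *\<^sub>R R1 x" using x by (simp add: S_def P_def T_def)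
    then have "x \<in> D" using resolvesD(2)[OF R1, of x] subspace_scale[OF D] by metis
    have "A x = d *\<^sub>R A (R1 x)" using A_scale[OF resolvesD(2)[OF R1, of x], of d] xT by simp
    also have "\<dots> = \<mu>1 *\<^sub>R x - d *\<^sub>R x"
    proof -
      have "d *\<^sub>R (\<mu>1 *\<^sub>R R1 x) = \<mu>1 *\<^sub>R x" using xT by (metis scaleR_left_commute)
      then show ?thesis by (simp add: resolvesD(3)[OF R1] scaleR_diff_right)
    qed
    also have "\<dots> = lam *\<^sub>R x" by (simp add: d_def scaleR_diff_left)
    finally obtain c where c: "x = c *\<^sub>R v" using simple \<open>x \<in> D\<close> by blast
    then have "c = 0" using \<open>\<psi> x = 0\<close> s by (simp add: psi.scaleR s_def)
    then show ?thesis using c by simp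
  qed
  define M where "M x = x - S x" for x
  have bijM: "bij M" unfolding M_def using S.injective_imp_bij[OF inj] .
  have M: "bounded_linear M"
    unfolding M_def by (intro bounded_linear_sub bounded_linear_ident S.S_bl)
  have ZM: "inv M (M x) = x" and MZ: "M (inv M x) = x" for x
    using bijM by (simp_all add: bij_is_inj bij_is_surj surj_f_inv_f)
  obtain \<eta>0 KY where \<eta>0: "\<eta>0 > 0" "KY > 0"
    and pert: "\<And>\<eta>. 0 \<le> \<eta> \<Longrightarrow> \<eta> \<le> \<eta>0 \<Longrightarrow> \<exists>Y. bounded_linear Y \<and> (\<forall>x. Y (M x - \<eta> *\<^sub>R T x) = x) \<and>
       (\<forall>y. M (Y y) - \<eta> *\<^sub>R T (Y y) = y) \<and> (\<forall>y. norm (Y y) \<le> KY * norm y)"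
    by (rule perturbed_inverse[OF M T bounded_linear_inv[OF M bijM] ZM MZ]) (rule that; assumption)
  obtain kp where kp: "kp > 0" "\<And>f. \<phi> (lmod f) \<le> kp * norm f" using phi_lmod_bound by blast
  define k where "k = 1 + b' / s * \<phi> v"
  have k: "k > 0" using psi_up(1) s phi_v by (simp add: k_def add_pos_nonneg)
  have phi_g: "\<phi> (lmod (f - P f)) \<le> k * \<phi> (lmod f)" for f
  proof -
    have "\<phi> (lmod (f - P f)) \<le> \<phi> (lmod f + (b' * \<phi> (lmod f) / s) *\<^sub>R v)"
      by (intro phi_mono order_trans[OF lmod_triangle_minus add_left_mono] P_lmod)
    also have "\<dots> = k * \<phi> (lmod f)" by (simp add: phi.add phi.scaleR k_def algebra_simps)
    finally show ?thesis .
  qed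
  \<comment> \<open>Bound for the regular part. In the second summand
    \<open>d * (C * k) * norm u\<close> bounds the norm after T, \<open>KY\<close> accounts for Y,
    \<open>kp\<close> leads back from norm to \<phi>, C is the last R1, and 2 bounds 1 +
    \<eta>.\<close>
  define E where "E = C * k + 2 * (C * (kp * (KY * (d * (C * k) * norm u))))"
  have E: "E > 0" unfolding E_def using C k kp \<eta>0 d by (intro add_pos_nonneg mult_pos_pos mult_nonneg_nonneg) auto
  \<comment> \<open>The three entries make the perturbed inverse available, keep 1 - \<eta> nonzero
    and 1 + \<eta> at most 2, and let the pole outweigh E + 1.\<close>
  define \<eta>1 where "\<eta>1 = min (min \<eta>0 (1/2)) (b0 * a / (d * s * (E + 1)))"
  have \<eta>1: "\<eta>1 > 0" "\<eta>1 \<le> \<eta>0" "\<eta>1 \<le> 1/2" "\<eta>1 \<le> b0 * a / (d * s * (E + 1))"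
  proof -
    have "\<eta>1 \<le> min \<eta>0 (1/2)" unfolding \<eta>1_def by (rule min.cobounded1)
    then show "\<eta>1 \<le> \<eta>0" "\<eta>1 \<le> 1/2" by (simp_all only: min.bounded_iff)
    show "\<eta>1 \<le> b0 * a / (d * s * (E + 1))" unfolding \<eta>1_def by (rule min.cobounded2)
    show "\<eta>1 > 0" using \<eta>0 psi_lo(1) a(1) d s E by (simp add: \<eta>1_def)
  qed
  show ?thesis
  proof
    show "d * \<eta>1 > 0" using d \<eta>1 by simp
    fix \<mu> assume \<mu>: "lam - d * \<eta>1 < \<mu>" "\<mu> < lam"
    \<comment> \<open>In these units (\<mu> - A) R1 = I - (1 + \<eta>) T, which agrees with M -
      \<eta> T on the kernel of \<psi>.\<close>
    define \<eta> where "\<eta> = (lam - \<mu>) / d"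
    have \<eta>: "0 < \<eta>" "\<eta> < \<eta>1" using \<mu> d by (simp_all add: \<eta>_def field_simps)
    have mu: "\<mu> = lam - d * \<eta>" using d by (simp add: \<eta>_def)
    obtain Y where Y: "bounded_linear Y" and YM: "\<And>x. Y (M x - \<eta> *\<^sub>R T x) = x"
      and MY: "\<And>y. M (Y y) - \<eta> *\<^sub>R T (Y y) = y" and Yn: "\<And>y. norm (Y y) \<le> KY * norm y"
      using pert[of \<eta>] \<eta> \<eta>1 by auto
    interpret Y: bounded_linear Y by (rule Y)
    \<comment> \<open>On the kernel of \<psi> the resolvent is R1 Y; along v it is multiplication by
      1/(\<mu> - lam) = -1/(d \<eta>).\<close>
    define R where "R f = R1 (Y (f - P f)) - (\<psi> f / s / (d * \<eta>)) *\<^sub>R v" for f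
    have M\<eta>: "M g - \<eta> *\<^sub>R T g = g - (1 + \<eta>) *\<^sub>R T g" if "P g = 0" for g
      using that by (simp add: M_def S_def algebra_simps)
    have psig: "\<psi> (f - P f) = 0" for f by (simp add: psi.diff psiP)
    \<comment> \<open>Applying \<psi> to the equation for Y g gives (1 - \<eta>) \<psi>(Y g) = 0, so
      Y leaves the kernel of \<psi> invariant.\<close>
    have Yeq: "Y g - (1 + \<eta>) *\<^sub>R T (Y g) = g" if "\<psi> g = 0" for g
    proof -
      have eq: "Y g - T (Y g) + P (Y g) - \<eta> *\<^sub>R T (Y g) = g" using MY[of g] by (simp add: M_def S_def algebra_simps)
      from arg_cong[OF this, of \<psi>] have "(1 - \<eta>) * \<psi> (Y g) = 0"
        using that by (simp add: psi.diff psi.add psi.scaleR psiT psiP algebra_simps)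
      then have "P (Y g) = 0" using \<eta> \<eta>1 by (simp add: P_def)
      with eq show ?thesis by (simp add: algebra_simps)
    qed
    have right: "R f \<in> D" "\<mu> *\<^sub>R R f - A (R f) = f" for f
    proof -
      define g where "g = f - P f"
      define c where "c = - (\<psi> f / s / (d * \<eta>))"
      have cv: "c *\<^sub>R v \<in> D" using v(1) by (rule subspace_scale[OF D])
      have Rf: "R f = R1 (Y g) + c *\<^sub>R v" by (simp add: R_def g_def c_def)
      show "R f \<in> D" unfolding Rf using subspace_add[OF D resolvesD(2)[OF R1] cv] .
      have "A (R f) = A (R1 (Y g)) + c *\<^sub>R (lam *\<^sub>R v)"
        unfolding Rf A_add[OF resolvesD(2)[OF R1] cv] A_scale[OF v(1)] v(2) ..
      then have "\<mu> *\<^sub>R R f - A (R f) = (\<mu> *\<^sub>R R1 (Y g) - A (R1 (Y g))) + (c * (\<mu> - lam)) *\<^sub>R v"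
        unfolding Rf by (simp add: algebra_simps)
      also have "\<mu> *\<^sub>R R1 (Y g) - A (R1 (Y g)) = Y g - (1 + \<eta>) *\<^sub>R T (Y g)"
        by (simp add: resolvesD(3)[OF R1] T_def mu d_def algebra_simps)
      also have "\<dots> = g" unfolding g_def by (rule Yeq[OF psig])
      also have "c * (\<mu> - lam) = \<psi> f / s" using d \<eta> by (simp add: mu c_def)
      finally show "\<mu> *\<^sub>R R f - A (R f) = f" by (simp add: P_def g_def)
    qed
    \<comment> \<open>Comparing \<psi>(A z) for the two values lam and \<mu> forces \<psi> z = 0,
      and then M - \<eta> T annihilates z. Injectivity upgrades the right inverse to a two-sided
      one.\<close>
    have inj\<mu>: "z = 0" if z: "z \<in> D" "A z = \<mu> *\<^sub>R z" for z
    proof -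
      have "lam * \<psi> z = \<mu> * \<psi> z" using psi(2)[OF z(1)] by (auto simp: z(2) psi.scaleR)
      then have "\<psi> z = 0" using \<mu> by simp
      have "\<mu> *\<^sub>R R1 z = \<mu>1 *\<^sub>R R1 z - z" using resolvesD(4)[OF R1 z(1)] by (simp add: z(2) R1.scaleR)
      then have "(1 + \<eta>) *\<^sub>R T z = z" by (simp add: T_def mu d_def algebra_simps)
      then have "M z - \<eta> *\<^sub>R T z = 0"
        using M\<eta>[of z] \<open>\<psi> z = 0\<close> by (simp add: P_def)
      with YM[of z] show ?thesis by (simp add: Y.zero)
    qed
    have left: "R (\<mu> *\<^sub>R x - A x) = x" if x: "x \<in> D" for x
    proof -
      let ?w = "\<mu> *\<^sub>R x - A x"
      have nx: "- x \<in> D" "A (- x) = - A x"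
        using x subspace_neg[OF D x] A_scale[OF x, of "-1"] by simp_all
      have "R ?w + - x = 0"
      proof (rule inj\<mu>)
        show "R ?w + - x \<in> D" using subspace_add[OF D right(1) nx(1)] .
        have "A (R ?w) = \<mu> *\<^sub>R R ?w - ?w" using right(2)[of ?w] by (metis add_diff_cancel_left' diff_add_cancel)
        then show "A (R ?w + - x) = \<mu> *\<^sub>R (R ?w + - x)"
          unfolding A_add[OF right(1) nx(1)] nx(2) by (simp add: algebra_simps)
      qed
      then show ?thesis by simp
    qed
    have "bounded_linear R"
      unfolding R_def
      by (intro bounded_linear_sub bounded_linear_compose[OF R1.bounded_linear_axioms]
          bounded_linear_compose[OF Y] bounded_linear_ident P bounded_linear_scaleR_const
          bounded_linear_divide[THEN bounded_linear_compose] psi)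
    with left right have "resolves D A \<mu> R" by (simp add: resolves_def)
    moreover have "R f \<le> - (\<phi> f *\<^sub>R u)" if f: "0 \<le> f" for f
    proof -
      let ?g = "f - P f"
      have pf: "0 \<le> \<phi> f" using f by (rule phi_nonneg)
      have g0: "P ?g = 0" unfolding P_def[of ?g] psig by simp
      \<comment> \<open>Y is controlled in norm only, and \<phi>(f) does not control the norm of f.
        Splitting off a factor T on the right places Y between two dominated operators: T leads from
        \<phi> to the norm, and the outer R1 back to a multiple of u.\<close>
      have "Y ?g = ?g + (1 + \<eta>) *\<^sub>R Y (T ?g)"
      proof -
        have "Y ?g - (1 + \<eta>) *\<^sub>R Y (T ?g) = ?g"
          using YM[of ?g] by (simp only: M\<eta>[OF g0] Y.diff[of ?g] Y.scaleR)
        then show ?thesis by (metis diff_add_cancel)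
      qed
      then have "R1 (Y ?g) = R1 ?g + (1 + \<eta>) *\<^sub>R R1 (Y (T ?g))" by (simp only: R1.add R1.scaleR)
      then have "R1 (Y ?g) \<le> lmod (R1 ?g) + (1 + \<eta>) *\<^sub>R lmod (R1 (Y (T ?g)))"
        using \<eta> by (simp only:) (intro add_mono scaleR_left_mono lmod_upper, simp)
      also have "\<dots> \<le> (C * (k * \<phi> f)) *\<^sub>R u + 2 *\<^sub>R ((C * (kp * (KY * (d * (C * (k * \<phi> f)) * norm u)))) *\<^sub>R u)"
      proof (intro add_mono scaleR_mono)
        have pg: "C * \<phi> (lmod ?g) \<le> C * (k * \<phi> f)" using phi_g[of f] f C by simp
        show 1: "lmod (R1 ?g) \<le> (C * (k * \<phi> f)) *\<^sub>R u"
          using dom pg u_nonneg by (rule scaleR_le_scaleR)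
        have "norm (R1 ?g) \<le> C * (k * \<phi> f) * norm u"
          using norm_le_of_lmod_le[OF 1] C k pf by simp
        then have "norm (T ?g) \<le> d * (C * (k * \<phi> f)) * norm u"
          using d by (simp add: T_def mult.assoc)
        then have "KY * norm (T ?g) \<le> KY * (d * (C * (k * \<phi> f)) * norm u)" using \<eta>0 by simp
        with Yn[of "T ?g"] have "norm (Y (T ?g)) \<le> KY * (d * (C * (k * \<phi> f)) * norm u)" by linarith
        then have "kp * norm (Y (T ?g)) \<le> kp * (KY * (d * (C * (k * \<phi> f)) * norm u))" using kp by simp
        with kp(2)[of "Y (T ?g)"] have "\<phi> (lmod (Y (T ?g))) \<le> kp * (KY * (d * (C * (k * \<phi> f)) * norm u))"
          by linarith
        then have "C * \<phi> (lmod (Y (T ?g))) \<le> C * (kp * (KY * (d * (C * (k * \<phi> f)) * norm u)))" using C by simp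
        with dom show "lmod (R1 (Y (T ?g))) \<le> (C * (kp * (KY * (d * (C * (k * \<phi> f)) * norm u)))) *\<^sub>R u"
          using u_nonneg by (rule scaleR_le_scaleR)
      qed (use \<eta> \<eta>1 in auto)
      also have "\<dots> = (E * \<phi> f) *\<^sub>R u"
        unfolding scaleR_scaleR scaleR_add_left[symmetric] E_def by (simp add: algebra_simps)
      finally have 1: "R1 (Y ?g) \<le> (E * \<phi> f) *\<^sub>R u" .
      have "(b0 * \<phi> f / s / (d * \<eta>)) *\<^sub>R (a *\<^sub>R u) \<le> (\<psi> f / s / (d * \<eta>)) *\<^sub>R v"
      proof (rule scaleR_mono'[OF _ a(2)])
        show "b0 * \<phi> f / s / (d * \<eta>) \<le> \<psi> f / s / (d * \<eta>)"
          using psi_lo(2)[OF f] s d \<eta> by (intro divide_right_mono) auto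
        show "0 \<le> b0 * \<phi> f / s / (d * \<eta>)" using psi_lo(1) pf s d \<eta> by simp
        show "0 \<le> a *\<^sub>R u" using a(1) u_nonneg by (simp add: scaleR_nonneg_nonneg)
      qed
      moreover have "((E + 1) * \<phi> f) *\<^sub>R u \<le> (b0 * \<phi> f / s / (d * \<eta>)) *\<^sub>R (a *\<^sub>R u)"
      proof -
        have "\<eta> * (d * s * (E + 1)) \<le> b0 * a"
          using \<eta>(2) \<eta>1(4) d s E by (simp add: pos_le_divide_eq) (smt (verit) mult_right_mono mult_pos_pos)
        then have "E + 1 \<le> b0 * a / s / (d * \<eta>)"
          using d s \<eta> by (simp add: field_simps)
        then have "(E + 1) * \<phi> f \<le> b0 * a / s / (d * \<eta>) * \<phi> f" using pf by (rule mult_right_mono)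
        then have "(E + 1) * \<phi> f \<le> b0 * \<phi> f / s / (d * \<eta>) * a" by (simp add: mult_ac)
        then show ?thesis using u_nonneg by (simp add: scaleR_right_mono del: scaleR_scaleR add: scaleR_scaleR[of _ a])
      qed
      ultimately have "((E + 1) * \<phi> f) *\<^sub>R u \<le> (\<psi> f / s / (d * \<eta>)) *\<^sub>R v" by (rule order_trans[rotated])
      then have "R f \<le> (E * \<phi> f) *\<^sub>R u - ((E + 1) * \<phi> f) *\<^sub>R u"
        unfolding R_def using 1 by (rule diff_mono[rotated])
      also have "\<dots> = - (\<phi> f *\<^sub>R u)" by (simp add: distrib_right scaleR_add_left)
      finally show ?thesis .
    qed
    ultimately show "\<exists>R. resolves D A \<mu> R \<and> (\<forall>f\<ge>0. R f \<le> - (\<phi> f *\<^sub>R u))" by blast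
  qed
qed

end

subsection \<open>Complexification\<close>

lemma Epos_iff: "z \<in> Epos \<longleftrightarrow> snd z = 0 \<and> 0 \<le> fst z"
  by (auto simp: Epos_def leE_def ER_def)

text \<open>\<open>Epos\<close> consists of real vectors, so positivity is decided by the real part
  of the operator. The criterion serves resolvents, rank one operators and their combinations
  alike.\<close>

lemma pos_op_real_iff:
  assumes T: "\<And>x. T (x, 0) = (B x, 0)"
  shows "pos_op T \<longleftrightarrow> (\<forall>f\<ge>0. 0 \<le> B f)"
proof
  assume p: "pos_op T"
  show "\<forall>f\<ge>0. 0 \<le> B f"
  proof (intro allI impI)
    fix f :: 'a assume "0 \<le> f"
    then have "(f, 0) \<in> Epos" by (simp add: Epos_iff)
    then have "T (f, 0) \<in> Epos" using p unfolding pos_op_def by blast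
    then show "0 \<le> B f" by (simp add: T Epos_iff)
  qed
next
  assume nn: "\<forall>f\<ge>0. 0 \<le> B f"
  show "pos_op T"
    unfolding pos_op_def
  proof
    fix z :: "'a cpx" assume "z \<in> Epos"
    then have z: "z = (fst z, 0)" "0 \<le> fst z" by (simp_all add: Epos_iff prod_eq_iff)
    have "T z = (B (fst z), 0)" by (subst z(1)) (rule T)
    then show "T z \<in> Epos" using nn z(2) by (simp add: Epos_iff)
  qed
qed

lemma cmul_of_real: "cmul (complex_of_real c) z = c *\<^sub>R z"
  by (simp add: cmul_def scaleR_prod_def)

lemma cmul_ii: "cmul \<i> (x, 0) = (0, x)"
  by (simp add: cmul_def)

text \<open>The angles 0 and pi give x and -x; any other angle only multiplies x by a factor of
  modulus at most 1.\<close>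

lemma latmod_real: "latmod x 0 = lmod x"
  unfolding latmod_def
proof (rule the_equality)
  have "cos t *\<^sub>R x \<le> lmod x" for t
  proof -
    have "cos t *\<^sub>R x \<le> \<bar>cos t\<bar> *\<^sub>R lmod x" using lmod_scaleR_le lmod_upper(1) order_trans by blast
    then show ?thesis using scaleR_le_scaleR[of _ _ "lmod x" 1] by simp
  qed
  moreover have "lmod x \<le> m" if "\<forall>t. cos t *\<^sub>R x + sin t *\<^sub>R 0 \<le> m" for m
    unfolding lmod_le_iff using that[rule_format, of 0] that[rule_format, of pi] by simp
  ultimately show *: "(\<forall>t. cos t *\<^sub>R x + sin t *\<^sub>R 0 \<le> lmod x) \<and>
      (\<forall>m'. (\<forall>t. cos t *\<^sub>R x + sin t *\<^sub>R 0 \<le> m') \<longrightarrow> lmod x \<le> m')"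
    by simp
  show "m = lmod x" if "(\<forall>t. cos t *\<^sub>R x + sin t *\<^sub>R 0 \<le> m) \<and>
      (\<forall>m'. (\<forall>t. cos t *\<^sub>R x + sin t *\<^sub>R 0 \<le> m') \<longrightarrow> m \<le> m')" for m
    using that * by (blast intro: antisym)
qed

lemma modE_real: "modE (x, 0) = (lmod x, 0)"
  by (simp add: modE_def latmod_real)

lemma ideal_E_realD:
  assumes "(x, 0) \<in> ideal_E u" shows "\<exists>c. lmod x \<le> c *\<^sub>R fst u"
  using assms by (auto simp: ideal_E_def modE_real leE_def)

text \<open>The complexification of a real functional.\<close>

definition cfun :: "('r::banach_lattice \<Rightarrow> real) \<Rightarrow> 'r cpx \<Rightarrow> complex" where
  "cfun y z = Complex (y (fst z)) (y (snd z))"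

lemma cfun_in_dualE:
  assumes "bounded_linear y" shows "cfun y \<in> dualE"
proof -
  interpret y: bounded_linear y by fact
  have "cfun y = (\<lambda>z. complex_of_real (y (fst z)) + \<i> * complex_of_real (y (snd z)))"
    by (auto simp: cfun_def complex_eq_iff)
  moreover have "bounded_linear \<dots>"
    by (intro bounded_linear_add bounded_linear_const_mult bounded_linear_compose[OF bounded_linear_of_real]
        bounded_linear_compose[OF assms] bounded_linear_fst bounded_linear_snd)
  moreover have "cfun y (cmul \<i> z) = \<i> * cfun y z" for z
    by (simp add: cfun_def cmul_def complex_eq_iff linear_neg[OF y.linear])
  ultimately show ?thesis by (simp add: dualE_def)
qed

lemma dualE_eq_cfun:
  assumes f: "f \<in> dualE" and real: "\<And>x. Im (f (x, 0)) = 0"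
  shows "bounded_linear (\<lambda>x. Re (f (x, 0)))" "f = cfun (\<lambda>x. Re (f (x, 0)))"
proof -
  have bl: "bounded_linear f" and i: "f (cmul \<i> z) = \<i> * f z" for z
    using f unfolding dualE_def by blast+
  interpret f: bounded_linear f by (rule bl)
  show "bounded_linear (\<lambda>x. Re (f (x, 0)))"
    by (intro bounded_linear_compose[OF bounded_linear_Re] bounded_linear_compose[OF bl]
        bounded_linear_Pair bounded_linear_ident bounded_linear_zero)
  show "f = cfun (\<lambda>x. Re (f (x, 0)))"
  proof
    fix z
    have "f z = f ((fst z, 0) + cmul \<i> (snd z, 0))" by (simp add: cmul_ii)
    also have "\<dots> = f (fst z, 0) + \<i> * f (snd z, 0)" by (simp only: f.add i)
    finally show "f z = cfun (\<lambda>x. Re (f (x, 0))) z" using real by (simp add: cfun_def complex_eq_iff)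
  qed
qed

text \<open>Every real vector is a difference of positive ones, so a positive functional is real on
  real vectors and is the complexification of its restriction.\<close>

lemma dual_pos_eq_cfun:
  assumes f: "f \<in> dual_pos"
  obtains y where "bounded_linear y" "f = cfun y" "\<And>x. 0 \<le> x \<Longrightarrow> 0 \<le> y x"
proof -
  have fd: "f \<in> dualE" and pos: "\<And>z. z \<in> Epos \<Longrightarrow> Im (f z) = 0 \<and> 0 \<le> Re (f z)"
    using f by (auto simp: dual_pos_def)
  interpret f: bounded_linear f using fd by (simp add: dualE_def)
  have real: "Im (f (x, 0)) = 0" for x
  proof -
    obtain p n where pn: "0 \<le> p" "0 \<le> n" "x = p - n" "lmod x = p + n" by (rule nonneg_parts)
    have "f (x, 0) = f ((p, 0) - (n, 0))" by (simp add: pn(3))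
    then have "f (x, 0) = f (p, 0) - f (n, 0)" by (simp only: f.diff)
    then show ?thesis using pos[of "(p, 0)"] pos[of "(n, 0)"] pn by (simp add: Epos_iff)
  qed
  show ?thesis
    using that[OF dualE_eq_cfun[OF fd real]] pos by (simp add: Epos_iff)
qed

lemma ideal_D_cfunD:
  assumes "cfun y \<in> ideal_D (cfun p)"
  shows "\<exists>c\<ge>0. \<forall>f. \<bar>y f\<bar> \<le> c * p (lmod f)"
proof -
  obtain c where c: "c \<ge> 0" and le: "\<And>f g. f \<in> Epos \<Longrightarrow> leE (modE g) f \<Longrightarrow> cmod (cfun y g) \<le> c * Re (cfun p f)"
    using assms by (auto simp: ideal_D_def)
  have "\<bar>y f\<bar> \<le> c * p (lmod f)" for f
  proof -
    have "cmod (cfun y (f, 0)) \<le> c * Re (cfun p (lmod f, 0))"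
      by (rule le) (auto simp: Epos_iff modE_real leE_def ER_def)
    moreover have "\<bar>y f\<bar> \<le> cmod (cfun y (f, 0))"
      using abs_Re_le_cmod[of "cfun y (f, 0)"] by (simp add: cfun_def)
    ultimately show ?thesis by (simp add: cfun_def)
  qed
  with c show ?thesis by blast
qed

section \<open>Reduction of a real operator to the real lattice\<close>

locale real_operator =
  fixes D :: "'r::banach_lattice cpx set" and A :: "'r cpx \<Rightarrow> 'r cpx"
  assumes lin: "clinear_op D A" and dense: "densely_defined D" and real: "real_op D A"
begin

definition D0 :: "'r set" where "D0 = {x. (x, 0) \<in> D}"
definition A0 :: "'r \<Rightarrow> 'r" where "A0 x = fst (A (x, 0))"

lemma D_iff: "z \<in> D \<longleftrightarrow> fst z \<in> D0 \<and> snd z \<in> D0"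
proof -
  have D: "D = {x + cmul \<i> y | x y. x \<in> D \<inter> ER \<and> y \<in> D \<inter> ER}" using real by (simp add: real_op_def)
  show ?thesis
  proof
    assume "z \<in> D"
    then obtain x y where xy: "z = x + cmul \<i> y" "x \<in> D" "x \<in> ER" "y \<in> D" "y \<in> ER"
      using D by blast
    then have e: "x = (fst x, 0)" "y = (fst y, 0)" by (auto simp: ER_def prod_eq_iff)
    have "z = (fst x, fst y)" using xy(1) e cmul_ii by (metis add.right_neutral add_0 add_Pair)
    then show "fst z \<in> D0 \<and> snd z \<in> D0" using xy e by (simp add: D0_def)
  next
    assume "fst z \<in> D0 \<and> snd z \<in> D0"
    moreover have "z = (fst z, 0) + cmul \<i> (snd z, 0)" by (simp add: cmul_ii)
    moreover have "(fst z, 0) \<in> ER" "(snd z, 0) \<in> ER" by (simp_all add: ER_def)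
    ultimately show "z \<in> D"
      unfolding D0_def mem_Collect_eq by (subst D) blast
  qed
qed

lemma A_real: "x \<in> D0 \<Longrightarrow> A (x, 0) = (A0 x, 0)"
  using real by (auto simp: real_op_def D0_def A0_def ER_def prod_eq_iff)

lemma A_eq: "z \<in> D \<Longrightarrow> A z = (A0 (fst z), A0 (snd z))"
proof -
  assume "z \<in> D"
  then have z: "fst z \<in> D0" "snd z \<in> D0" by (simp_all add: D_iff)
  then have in_D: "(fst z, 0) \<in> D" "(snd z, 0) \<in> D" by (simp_all add: D0_def)
  have "A z = A ((fst z, 0) + cmul \<i> (snd z, 0))" by (simp add: cmul_ii)
  also have "\<dots> = A (fst z, 0) + cmul \<i> (A (snd z, 0))"
    using lin in_D by (simp add: clinear_op_def)
  finally show ?thesis using z by (simp add: A_real cmul_ii)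
qed

lemma D0_subspace: "subspace D0"
  and A0_add: "x \<in> D0 \<Longrightarrow> y \<in> D0 \<Longrightarrow> A0 (x + y) = A0 x + A0 y"
  and A0_scale: "x \<in> D0 \<Longrightarrow> A0 (c *\<^sub>R x) = c *\<^sub>R A0 x"
proof -
  have add: "(x + y, 0) \<in> D \<and> A (x + y, 0) = A (x, 0) + A (y, 0)" if "x \<in> D0" "y \<in> D0" for x y
  proof -
    have "(x + y, 0) = (x, 0) + (y, 0::'r)" by simp
    then show ?thesis using lin that unfolding clinear_op_def D0_def by (metis mem_Collect_eq)
  qed
  have scale: "(c *\<^sub>R x, 0) \<in> D \<and> A (c *\<^sub>R x, 0) = c *\<^sub>R A (x, 0)" if "x \<in> D0" for c x
  proof -
    have "(c *\<^sub>R x, 0) = cmul (complex_of_real c) (x, 0::'r)" by (simp add: cmul_of_real)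
    then show ?thesis using lin that unfolding clinear_op_def D0_def by (metis mem_Collect_eq cmul_of_real)
  qed
  have "(0, 0) \<in> D" using lin by (simp add: clinear_op_def flip: zero_prod_def)
  then show "subspace D0" using add scale by (simp add: subspace_def D0_def)
  show "A0 (x + y) = A0 x + A0 y" if "x \<in> D0" "y \<in> D0" using add[OF that] by (simp add: A0_def)
  show "A0 (c *\<^sub>R x) = c *\<^sub>R A0 x" if "x \<in> D0" using scale[OF that] by (simp add: A0_def)
qed

lemma resolves_imp_unique:
  assumes R: "resolves D0 A0 \<mu> R"
  shows "x \<in> D \<and> cmul (of_real \<mu>) x - A x = y \<longleftrightarrow> x = (R (fst y), R (snd y))"
proof
  assume x: "x \<in> D \<and> cmul (of_real \<mu>) x - A x = y"
  then have "y = (\<mu> *\<^sub>R fst x - A0 (fst x), \<mu> *\<^sub>R snd x - A0 (snd x))"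
    by (auto simp: cmul_of_real A_eq prod_eq_iff)
  moreover have "fst x \<in> D0" "snd x \<in> D0" using x by (simp_all add: D_iff)
  ultimately show "x = (R (fst y), R (snd y))" using R by (simp add: resolves_def)
next
  assume x: "x = (R (fst y), R (snd y))"
  then have "x \<in> D" using R by (simp add: D_iff resolves_def)
  moreover have "cmul (of_real \<mu>) x - A x = y"
    using R x \<open>x \<in> D\<close> by (simp add: cmul_of_real A_eq prod_eq_iff resolves_def)
  ultimately show "x \<in> D \<and> cmul (of_real \<mu>) x - A x = y" by simp
qed

lemma resolvent_eq:
  assumes R: "resolves D0 A0 \<mu> R"
  shows "resolvent D A (of_real \<mu>) y = (R (fst y), R (snd y))"
  by (simp add: resolvent_def resolves_imp_unique[OF R])

lemma resolves_imp_resolvent_set: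
  assumes R: "resolves D0 A0 \<mu> R"
  shows "complex_of_real \<mu> \<in> resolvent_set D A"
proof -
  have bl: "bounded_linear R" using R by (rule resolvesD)
  have "bounded_linear (\<lambda>y. (R (fst y), R (snd y)))"
    by (intro bounded_linear_Pair bounded_linear_compose[OF bl] bounded_linear_fst bounded_linear_snd)
  moreover have "resolvent D A (of_real \<mu>) = (\<lambda>y. (R (fst y), R (snd y)))"
    by (rule ext) (rule resolvent_eq[OF R])
  ultimately show ?thesis by (simp add: resolvent_set_def resolves_imp_unique[OF R])
qed

text \<open>Domain and operator act componentwise, so the real component of the complex resolvent,
  restricted to real vectors, already inverts the real operator.\<close>

lemma resolvent_set_imp_resolves:
  assumes mu: "complex_of_real \<mu> \<in> resolvent_set D A"
  obtains R where "resolves D0 A0 \<mu> R"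
proof -
  let ?r = "resolvent D A (of_real \<mu>)"
  have ex: "\<exists>!x. x \<in> D \<and> cmul (of_real \<mu>) x - A x = y" for y using mu unfolding resolvent_set_def by blast
  have bl: "bounded_linear ?r" using mu by (simp add: resolvent_set_def)
  have r: "?r y \<in> D" "cmul (of_real \<mu>) (?r y) - A (?r y) = y" for y
    using theI'[OF ex[of y]] by (simp_all add: resolvent_def)
  have r': "?r (cmul (of_real \<mu>) x - A x) = x" if "x \<in> D" for x
    unfolding resolvent_def using ex that by (intro the1_equality) auto
  define R where "R y = fst (?r (y, 0))" for y
  have "bounded_linear R"
    unfolding R_def
    by (intro bounded_linear_compose[OF bounded_linear_fst] bounded_linear_compose[OF bl]
        bounded_linear_Pair bounded_linear_ident bounded_linear_zero)
  moreover have "R y \<in> D0" "\<mu> *\<^sub>R R y - A0 (R y) = y" for y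
  proof -
    show "R y \<in> D0" using r(1)[of "(y, 0)"] by (simp add: R_def D_iff)
    have "cmul (of_real \<mu>) (?r (y, 0)) - A (?r (y, 0)) = (y, 0)" by (rule r)
    then show "\<mu> *\<^sub>R R y - A0 (R y) = y"
      using r(1)[of "(y, 0)"] by (simp add: cmul_of_real A_eq R_def prod_eq_iff)
  qed
  moreover have "R (\<mu> *\<^sub>R x - A0 x) = x" if "x \<in> D0" for x
    using r'[of "(x, 0)"] that by (simp add: D0_def cmul_of_real A_real R_def)
  ultimately have "resolves D0 A0 \<mu> R" by (simp add: resolves_def)
  then show ?thesis by (rule that)
qed

text \<open>Density of the domain is what makes the definite description in \<open>adj\<close>
  meaningful.\<close>

lemma dualE_unique:
  assumes f: "f \<in> dualE" and g: "g \<in> dualE" and eq: "\<And>x. x \<in> D \<Longrightarrow> f x = g x"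
  shows "f = g"
proof
  fix z
  have "continuous_on UNIV f" "continuous_on UNIV g"
    using f g by (simp_all add: dualE_def linear_continuous_on)
  then have "closed {x. f x = g x}" by (intro closed_Collect_eq)
  then have "closure D \<subseteq> {x. f x = g x}" using eq by (intro closure_minimal) auto
  then show "f z = g z" using dense by (auto simp: densely_defined_def)
qed

lemma adj_eq:
  assumes "f \<in> dualE" "g \<in> dualE" "\<And>x. x \<in> D \<Longrightarrow> f (A x) = g x"
  shows "f \<in> adj_dom D A" "adj D A f = g"
proof -
  show "f \<in> adj_dom D A" using assms by (auto simp: adj_dom_def)
  show "adj D A f = g"
    unfolding adj_def using assms by (intro the_equality) (auto intro!: dualE_unique)
qed

lemma adj_dom_apply:
  assumes "f \<in> adj_dom D A" "x \<in> D" shows "f (A x) = adj D A f x"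
proof -
  obtain g where g: "f \<in> dualE" "g \<in> dualE" "\<And>x. x \<in> D \<Longrightarrow> f (A x) = g x"
    using assms(1) by (auto simp: adj_dom_def)
  then show ?thesis using adj_eq(2)[OF g] assms(2) by simp
qed

text \<open>A R^(m+1) f = R^m (\<mu> R f - f) is again a value of R^m, at another vector; hence the
  induction over all f.\<close>

lemma funpow_resolvent_in_pow_dom:
  assumes R: "resolves D0 A0 \<mu> R"
  shows "((R ^^ m) f, 0) \<in> pow_dom UNIV D A m"
proof (induction m arbitrary: f)
  case (Suc m)
  interpret Rm: bounded_linear "R ^^ m" by (rule bounded_linear_funpow[OF resolvesD(1)[OF R]])
  let ?x = "(R ^^ Suc m) f"
  have x: "?x \<in> D0" using resolvesD(2)[OF R] by simp
  have "A0 ?x = (R ^^ m) (\<mu> *\<^sub>R R f - f)"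
    using resolvesD(3)[OF R, of "(R ^^ m) f"] by (simp add: Rm.diff Rm.scaleR funpow_swap1)
  then show ?case using x Suc.IH by (simp add: A_real[OF x, simplified] D_iff subspace_0[OF D0_subspace])
qed simp

text \<open>The dual counterpart: the adjoint sends y composed with R^(m+1) to y' composed with R^m,
  where y' f = \<mu> y(R f) - y f is again bounded; hence the induction over all y.\<close>

lemma functional_funpow_resolvent_in_pow_dom:
  assumes R: "resolves D0 A0 \<mu> R" and y: "bounded_linear y"
  shows "cfun (\<lambda>f. y ((R ^^ m) f)) \<in> pow_dom dualE (adj_dom D A) (adj D A) m"
  using y
proof (induction m arbitrary: y)
  case 0 then show ?case by (simp add: cfun_in_dualE)
next
  case (Suc m)
  interpret y: bounded_linear y by fact
  interpret R: bounded_linear R using R by (rule resolvesD)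
  interpret Rm: bounded_linear "R ^^ m" by (rule bounded_linear_funpow[OF R.bounded_linear_axioms])
  define y' where "y' f = \<mu> * y (R f) - y f" for f
  have y': "bounded_linear y'"
    unfolding y'_def by (intro bounded_linear_sub bounded_linear_const_mult Suc.prems
        bounded_linear_compose[OF Suc.prems R.bounded_linear_axioms])
  have eq: "y ((R ^^ Suc m) (A0 x)) = y' ((R ^^ m) x)" if "x \<in> D0" for x
  proof -
    have "(R ^^ Suc m) (A0 x) = (R ^^ m) (R (A0 x))" by (simp add: funpow_swap1)
    also have "\<dots> = \<mu> *\<^sub>R R ((R ^^ m) x) - (R ^^ m) x"
      by (simp add: resolvesD(4)[OF R that] Rm.diff Rm.scaleR funpow_swap1)
    finally show ?thesis by (simp add: y'_def y.diff y.scaleR)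
  qed
  have 1: "cfun (\<lambda>f. y ((R ^^ Suc m) f)) \<in> dualE"
    by (intro cfun_in_dualE bounded_linear_compose[OF Suc.prems] bounded_linear_funpow R.bounded_linear_axioms)
  have 2: "cfun (\<lambda>f. y' ((R ^^ m) f)) \<in> dualE"
    by (intro cfun_in_dualE bounded_linear_compose[OF y'] Rm.bounded_linear_axioms)
  have 3: "cfun (\<lambda>f. y ((R ^^ Suc m) f)) (A x) = cfun (\<lambda>f. y' ((R ^^ m) f)) x" if "x \<in> D" for x
    using that eq by (simp add: cfun_def A_eq D_iff del: funpow.simps)
  show ?case using adj_eq[OF 1 2 3] Suc.IH[OF y'] by simp
qed

end

section \<open>The equivalence for the complex operator\<close>

theorem theorem5p3:
  fixes D :: "'r::banach_lattice cpx set" and A :: "'r cpx \<Rightarrow> 'r cpx"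
    and u v :: "'r cpx" and \<phi> \<psi> :: "'r cpx \<Rightarrow> complex"
    and m1 m2 :: nat and lam0 \<mu>1 :: real
  assumes lin: "clinear_op D A" and dense: "densely_defined D"
    and closed: "closed_op D A" and real: "real_op D A"
    and u_pos: "u \<in> Epos" and phi_pos: "strictly_positive \<phi>"
    and dom1: "pow_dom UNIV D A m1 \<subseteq> ideal_E u"
    and dom2: "pow_dom dualE (adj_dom D A) (adj D A) m2 \<subseteq> ideal_D \<phi>"
    and eig_A: "\<exists>x\<in>D. x \<noteq> 0 \<and> A x = cmul (of_real lam0) x"
    and simple: "{x \<in> D. A x = cmul (of_real lam0) x} = {cmul c v | c. True}"
    and v_dom: "succE v u"
    and eig_A': "\<exists>\<theta>\<in>adj_dom D A. \<theta> \<noteq> (\<lambda>_. 0) \<and> adj D A \<theta> = (\<lambda>f. of_real lam0 * \<theta> f)"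
    and psi_ker: "\<psi> \<in> adj_dom D A" "adj D A \<psi> = (\<lambda>f. of_real lam0 * \<psi> f)"
    and psi_dom: "succD \<psi> \<phi>"
    and mu1: "\<mu>1 > lam0" "complex_of_real \<mu>1 \<in> resolvent_set D A"
    and mu1_lower: "succOp (resolvent D A (of_real \<mu>1)) (\<lambda>f. - rank1 u \<phi> f)"
  shows "((\<exists>\<epsilon>>0. (\<forall>\<mu>\<in>{lam0 - \<epsilon><..<lam0}. complex_of_real \<mu> \<in> resolvent_set D A) \<and>
              (\<forall>\<mu>\<in>{lam0 - \<epsilon><..<lam0}.
                 succOp (\<lambda>f. - rank1 u \<phi> f) (resolvent D A (of_real \<mu>))))
       \<longleftrightarrow> (\<exists>\<mu>0<lam0. complex_of_real \<mu>0 \<in> resolvent_set D A \<and>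
              pos_op (\<lambda>f. - resolvent D A (of_real \<mu>0) f)))
     \<and> ((\<exists>\<mu>0<lam0. complex_of_real \<mu>0 \<in> resolvent_set D A \<and>
              pos_op (\<lambda>f. - resolvent D A (of_real \<mu>0) f))
       \<longleftrightarrow> succOp (rank1 u \<phi>) (resolvent D A (of_real \<mu>1)))"
proof -
  interpret real_operator D A using lin dense real by unfold_locales
  define u0 where "u0 = fst u"
  define v0 where "v0 = fst v"
  have u: "u = (u0, 0)" and u0: "0 \<le> u0" using u_pos by (auto simp: Epos_iff u0_def prod_eq_iff)
  obtain a where a: "a > 0" "leE (a *\<^sub>R u) v" using v_dom by (auto simp: succE_def)
  have v: "v = (v0, 0)" and av: "a *\<^sub>R u0 \<le> v0"
    using a by (auto simp: leE_def ER_def u0_def v0_def prod_eq_iff)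
  have vpos: "0 \<le> v0" using av a(1) u0 order_trans[OF scaleR_nonneg_nonneg] by (metis less_imp_le)
  have eig: "x \<in> D \<and> A x = cmul (of_real lam0) x \<longleftrightarrow> (\<exists>c. x = cmul c v)" for x
    using simple by blast
  have "v = cmul 1 v" using cmul_of_real[of 1 v] by simp
  then have vD: "v \<in> D" "A v = lam0 *\<^sub>R v"
    using eig[of v] by (auto simp: cmul_of_real)
  have v0D: "v0 \<in> D0" "A0 v0 = lam0 *\<^sub>R v0"
    using vD by (simp_all add: v D0_def A0_def)
  \<comment> \<open>If v vanished, its multiples would span no eigenvector, against
    \<open>eig_A\<close>.\<close>
  have v_ne: "v0 \<noteq> 0"
  proof
    assume "v0 = 0"
    then have "cmul c v = 0" for c by (simp add: v cmul_def zero_prod_def)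
    then show False using eig_A eig by auto
  qed
  \<comment> \<open>An eigenvector lies in every power of the domain, so domination bounds v above
    by a multiple of u; the scalar c absorbs the powers of \<open>lam0\<close>.\<close>
  have "c *\<^sub>R v \<in> pow_dom UNIV D A m" for c m
  proof (induction m arbitrary: c)
    case (Suc m)
    have "c *\<^sub>R v \<in> D" using v0D(1) subspace_scale[OF D0_subspace] subspace_0[OF D0_subspace] by (simp add: v D_iff)
    moreover have "A (c *\<^sub>R v) = (c * lam0) *\<^sub>R v"
      using lin vD unfolding clinear_op_def by (metis cmul_of_real scaleR_scaleR)
    ultimately show ?case using Suc.IH by simp
  qed simp
  from this[of 1 m1] dom1 have "(v0, 0) \<in> ideal_E u" by (auto simp: v)
  then obtain a' where "lmod v0 \<le> a' *\<^sub>R u0" using ideal_E_realD[of v0 u] unfolding u0_def by blast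
  then have va': "v0 \<le> a' *\<^sub>R u0" using vpos by simp
  have u_ne: "u0 \<noteq> 0"
  proof
    assume "u0 = 0"
    then have "v0 \<le> 0" using va' by simp
    then show False using vpos v_ne by simp
  qed
  have "\<phi> \<in> dual_pos" using phi_pos unfolding strictly_positive_def by blast
  then obtain p where p: "bounded_linear p" "\<phi> = cfun p"
    by (rule dual_pos_eq_cfun) (rule that)
  have p_strict: "0 < p f" if "0 \<le> f" "f \<noteq> 0" for f
  proof -
    have "(f, 0) \<in> Epos" "(f, 0 :: 'r) \<noteq> 0" using that by (simp_all add: Epos_iff zero_prod_def)
    then have "0 < Re (\<phi> (f, 0))" using phi_pos by (simp add: strictly_positive_def)
    then show ?thesis by (simp add: p(2) cfun_def)
  qed
  interpret W: weighted_ideal u0 p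
    using u0 u_ne p(1) p_strict by (intro weighted_ideal.intro)
  obtain b0 where b0: "b0 > 0" "(\<lambda>f. \<psi> f - of_real b0 * \<phi> f) \<in> dual_pos"
    using psi_dom by (auto simp: succD_def)
  obtain r where r: "bounded_linear r" "(\<lambda>f. \<psi> f - of_real b0 * \<phi> f) = cfun r" "\<And>x. 0 \<le> x \<Longrightarrow> 0 \<le> r x"
    by (rule dual_pos_eq_cfun[OF b0(2)]) (rule that; assumption)
  \<comment> \<open>The real form of \<psi>: it is the sum of the positive difference \<psi> - b0
    \<phi> and of b0 \<phi>, both of which are real.\<close>
  define q where "q f = r f + b0 * p f" for f
  have psi_q: "\<psi> = cfun q"
  proof
    fix z
    have "\<psi> z = cfun r z + of_real b0 * \<phi> z" using fun_cong[OF r(2), of z] by (simp add: algebra_simps)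
    then show "\<psi> z = cfun q z" by (simp add: p(2) cfun_def q_def complex_eq_iff)
  qed
  have q: "bounded_linear q" unfolding q_def by (intro bounded_linear_add bounded_linear_const_mult r p)
  have q_lo: "b0 * p f \<le> q f" if "0 \<le> f" for f using r(3)[OF that] by (simp add: q_def)
  have q_eig: "q (A0 x) = lam0 * q x" if "x \<in> D0" for x
  proof -
    have "(x, 0) \<in> D" using that by (simp add: D0_def)
    from adj_dom_apply[OF psi_ker(1) this] have "\<psi> (A0 x, 0) = of_real lam0 * \<psi> (x, 0)"
      using that by (simp add: psi_ker(2) A_real)
    then show ?thesis by (simp add: psi_q cfun_def complex_eq_iff)
  qed
  \<comment> \<open>The same argument for the adjoint: \<psi> lies in every power of its domain and
    is therefore bounded by a multiple of \<phi>.\<close>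
  have q_scaled: "cfun (\<lambda>f. c * q f) \<in> pow_dom dualE (adj_dom D A) (adj D A) m" for c m
  proof (induction m arbitrary: c)
    case 0 then show ?case using q by (simp add: cfun_in_dualE bounded_linear_const_mult)
  next
    case (Suc m)
    have 1: "cfun (\<lambda>f. c * q f) \<in> dualE" "cfun (\<lambda>f. c * lam0 * q f) \<in> dualE"
      using q by (simp_all add: cfun_in_dualE bounded_linear_const_mult)
    have 2: "cfun (\<lambda>f. c * q f) (A x) = cfun (\<lambda>f. c * lam0 * q f) x" if "x \<in> D" for x
      using that by (simp add: cfun_def A_eq D_iff q_eig)
    show ?case using adj_eq[OF 1 2] Suc.IH[of "c * lam0"] by simp
  qed
  have "cfun q \<in> ideal_D (cfun p)" using q_scaled[of 1 m2] dom2 by (auto simp: p(2))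
  then obtain b1 where b1: "b1 \<ge> 0" "\<And>f. \<bar>q f\<bar> \<le> b1 * p (lmod f)" using ideal_D_cfunD by blast
  \<comment> \<open>Adding 1 makes the constant strictly positive.\<close>
  have b2: "\<bar>q f\<bar> \<le> (b1 + 1) * p (lmod f)" for f
    using b1(2)[of f] W.phi_nonneg[of "lmod f"] by (simp add: distrib_right)
  obtain R1 where R1: "resolves D0 A0 \<mu>1 R1" using resolvent_set_imp_resolves[OF mu1(2)] by blast
  have rank1: "rank1 u \<phi> z = (p (fst z) *\<^sub>R u0, p (snd z) *\<^sub>R u0)" for z
    by (simp add: rank1_def p(2) cfun_def cmul_def u)
  have pz: "p 0 = 0" by (rule W.phi.zero)
  have Rz: "R 0 = 0" if "resolves D0 A0 \<mu> R" for \<mu> R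
    using resolvesD(1)[OF that] by (simp add: linear_0 bounded_linear.linear)
  have neg_iff: "pos_op (\<lambda>f. - resolvent D A (of_real \<mu>) f) \<longleftrightarrow> (\<forall>f\<ge>0. 0 \<le> - R f)"
    if "resolves D0 A0 \<mu> R" for \<mu> R
    by (rule pos_op_real_iff) (simp add: resolvent_eq[OF that] Rz[OF that])
  have i_iff: "succOp (\<lambda>f. - rank1 u \<phi> f) (resolvent D A (of_real \<mu>)) \<longleftrightarrow>
      (\<exists>c>0. \<forall>f\<ge>0. 0 \<le> - (p f *\<^sub>R u0) - c *\<^sub>R R f)" if "resolves D0 A0 \<mu> R" for \<mu> R
    unfolding succOp_def
    by (intro arg_cong[where f=Ex] ext arg_cong2[where f="(\<and>)"] refl pos_op_real_iff)
      (simp add: resolvent_eq[OF that] Rz[OF that] rank1 pz)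
  have iii_iff: "succOp (rank1 u \<phi>) (resolvent D A (of_real \<mu>1)) \<longleftrightarrow>
      (\<exists>c>0. \<forall>f\<ge>0. 0 \<le> p f *\<^sub>R u0 - c *\<^sub>R R1 f)"
    unfolding succOp_def
    by (intro arg_cong[where f=Ex] ext arg_cong2[where f="(\<and>)"] refl pos_op_real_iff)
      (simp add: resolvent_eq[OF R1] Rz[OF R1] rank1 pz)
  have "succOp (resolvent D A (of_real \<mu>1)) (\<lambda>f. - rank1 u \<phi> f) \<longleftrightarrow>
      (\<exists>c>0. \<forall>f\<ge>0. 0 \<le> R1 f - c *\<^sub>R - (p f *\<^sub>R u0))"
    unfolding succOp_def
    by (intro arg_cong[where f=Ex] ext arg_cong2[where f="(\<and>)"] refl pos_op_real_iff)
      (simp add: resolvent_eq[OF R1] Rz[OF R1] rank1 pz)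
  then obtain cl where cl: "cl > 0" "\<And>f. 0 \<le> f \<Longrightarrow> 0 \<le> R1 f + (cl * p f) *\<^sub>R u0"
    using mu1_lower by auto
  let ?i = "\<exists>\<epsilon>>0. (\<forall>\<mu>\<in>{lam0 - \<epsilon><..<lam0}. complex_of_real \<mu> \<in> resolvent_set D A) \<and>
              (\<forall>\<mu>\<in>{lam0 - \<epsilon><..<lam0}. succOp (\<lambda>f. - rank1 u \<phi> f) (resolvent D A (of_real \<mu>)))"
  let ?ii = "\<exists>\<mu>0<lam0. complex_of_real \<mu>0 \<in> resolvent_set D A \<and>
              pos_op (\<lambda>f. - resolvent D A (of_real \<mu>0) f)"
  let ?iii = "succOp (rank1 u \<phi>) (resolvent D A (of_real \<mu>1))"
  have "?ii" if i: ?i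
  proof -
    obtain \<epsilon> where \<epsilon>: "\<epsilon> > 0" "\<And>\<mu>. lam0 - \<epsilon> < \<mu> \<Longrightarrow> \<mu> < lam0 \<Longrightarrow> complex_of_real \<mu> \<in> resolvent_set D A"
      "\<And>\<mu>. lam0 - \<epsilon> < \<mu> \<Longrightarrow> \<mu> < lam0 \<Longrightarrow> succOp (\<lambda>f. - rank1 u \<phi> f) (resolvent D A (of_real \<mu>))"
      using i by auto
    define \<mu> where "\<mu> = lam0 - \<epsilon> / 2"
    have \<mu>: "lam0 - \<epsilon> < \<mu>" "\<mu> < lam0" using \<epsilon>(1) by (simp_all add: \<mu>_def)
    obtain R where R: "resolves D0 A0 \<mu> R" using resolvent_set_imp_resolves[OF \<epsilon>(2)[OF \<mu>]] by blast
    obtain c where c: "c > 0" "\<And>f. 0 \<le> f \<Longrightarrow> 0 \<le> - (p f *\<^sub>R u0) - c *\<^sub>R R f"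
      using \<epsilon>(3)[OF \<mu>] i_iff[OF R] by auto
    have "0 \<le> - R f" if f: "0 \<le> f" for f
    proof -
      have "0 \<le> p f *\<^sub>R u0" using f u0 W.phi_nonneg by (simp add: scaleR_nonneg_nonneg)
      then have "c *\<^sub>R R f \<le> 0" using c(2)[OF f] by (simp add: le_diff_eq) (metis neg_le_0_iff_le order_trans)
      from scaleR_left_mono[OF this, of "1 / c"] c(1) show ?thesis by simp
    qed
    then have "pos_op (\<lambda>f. - resolvent D A (of_real \<mu>) f)" unfolding neg_iff[OF R] by (intro allI impI)
    then show ?ii using \<mu>(2) \<epsilon>(2)[OF \<mu>] by (intro exI[of _ \<mu>] conjI)
  qed
  moreover have "?iii" if ii: ?ii
  proof -
    obtain \<mu>0 where \<mu>0: "\<mu>0 < lam0" "complex_of_real \<mu>0 \<in> resolvent_set D A"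
      and neg: "pos_op (\<lambda>f. - resolvent D A (of_real \<mu>0) f)" using ii by blast
    obtain R0 where R0: "resolves D0 A0 \<mu>0 R0" using resolvent_set_imp_resolves[OF \<mu>0(2)] by blast
    have d1: "\<exists>c. lmod ((R0 ^^ m1) f) \<le> c *\<^sub>R u0" for f
      unfolding u0_def using funpow_resolvent_in_pow_dom[OF R0] dom1 by (intro ideal_E_realD) blast
    have d2: "\<exists>c. \<forall>f. \<bar>y ((R0 ^^ m2) f)\<bar> \<le> c * p (lmod f)" if "bounded_linear y" for y :: "'r \<Rightarrow> real"
    proof -
      have "cfun (\<lambda>f. y ((R0 ^^ m2) f)) \<in> ideal_D (cfun p)"
        using functional_funpow_resolvent_in_pow_dom[OF R0 that] dom2 p(2) by blast
      from ideal_D_cfunD[OF this] show ?thesis by blast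
    qed
    have R0_neg: "R0 f \<le> 0" if "0 \<le> f" for f using neg neg_iff[OF R0] that by simp
    have "\<mu>0 < \<mu>1" using \<mu>0 mu1 by simp
    then obtain K where K: "K > 0" "\<And>f. 0 \<le> f \<Longrightarrow> R1 f \<le> (K * p f) *\<^sub>R u0"
      by (rule W.negative_resolvent_imp_upper_bound[OF R0 R1 _ R0_neg d1 d2]) (assumption | (rule that; assumption))+
    have "0 \<le> p f *\<^sub>R u0 - (1 / K) *\<^sub>R R1 f" if "0 \<le> f" for f
      using scaleR_left_mono[OF K(2)[OF that], of "1 / K"] K(1) by simp
    then show ?iii unfolding iii_iff using K(1) by (intro exI[of _ "1 / K"]) simp
  qed
  moreover have "?i" if iii: ?iii
  proof -
    obtain c where c: "c > 0" "\<And>f. 0 \<le> f \<Longrightarrow> 0 \<le> p f *\<^sub>R u0 - c *\<^sub>R R1 f" using iii iii_iff by auto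
    \<comment> \<open>\<open>cl\<close> comes from the lower bound assumed for R(\<mu>1), 1/c from
      (iii); the maximum serves both sides.\<close>
    define C where "C = max cl (1 / c)"
    have C: "C > 0" using cl by (simp add: C_def)
    have R1_dom: "lmod (R1 f) \<le> (C * p (lmod f)) *\<^sub>R u0" for f
    proof (rule W.two_sided_bound_imp_dominated[OF resolvesD(1)[OF R1]])
      fix f :: 'r assume f: "0 \<le> f"
      have pf: "0 \<le> p f" using f by (rule W.phi_nonneg)
      have "- R1 f \<le> (cl * p f) *\<^sub>R u0" using cl(2)[OF f] by (metis add.commute le_add_same_cancel1 add_le_cancel_right left_minus)
      moreover have "cl * p f \<le> C * p f" using pf by (intro mult_right_mono) (auto simp: C_def)
      ultimately have "- R1 f \<le> (C * p f) *\<^sub>R u0" using u0 by (rule scaleR_le_scaleR)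
      then show "- ((C * p f) *\<^sub>R u0) \<le> R1 f" by (simp add: minus_le_iff)
      have "c *\<^sub>R R1 f \<le> p f *\<^sub>R u0" using c(2)[OF f] by simp
      from scaleR_left_mono[OF this, of "1 / c"] c(1) have "R1 f \<le> (1 / c * p f) *\<^sub>R u0" by simp
      moreover have "1 / c * p f \<le> C * p f" using pf by (intro mult_right_mono) (auto simp: C_def)
      ultimately show "R1 f \<le> (C * p f) *\<^sub>R u0" using u0 by (rule scaleR_le_scaleR)
    qed
    have ker: "\<exists>c. x = c *\<^sub>R v0" if x: "x \<in> D0" "A0 x = lam0 *\<^sub>R x" for x
    proof -
      have "(x, 0) \<in> D \<and> A (x, 0) = cmul (of_real lam0) (x, 0)"
        using x by (simp add: D0_def A_real cmul_of_real)
      then obtain c where "(x, 0) = cmul c v" using eig by blast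
      then show ?thesis by (auto simp: cmul_def v)
    qed
    have b1_pos: "b1 + 1 > 0" using b1(1) by simp
    obtain \<epsilon> where \<epsilon>: "\<epsilon> > 0" "\<And>\<mu>. lam0 - \<epsilon> < \<mu> \<Longrightarrow> \<mu> < lam0 \<Longrightarrow>
       \<exists>R. resolves D0 A0 \<mu> R \<and> (\<forall>f\<ge>0. R f \<le> - (p f *\<^sub>R u0))"
      by (rule W.dominated_resolvent_imp_negative_left[OF D0_subspace A0_add A0_scale R1 mu1(1) C R1_dom v0D ker
          a(1) av va' q q_eig b0(1) q_lo b1_pos b2]) (assumption | (rule that; assumption))+
    have "complex_of_real \<mu> \<in> resolvent_set D A \<and> succOp (\<lambda>f. - rank1 u \<phi> f) (resolvent D A (of_real \<mu>))"
      if \<mu>: "\<mu> \<in> {lam0 - \<epsilon><..<lam0}" for \<mu>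
    proof -
      obtain R where R: "resolves D0 A0 \<mu> R" "\<And>f. 0 \<le> f \<Longrightarrow> R f \<le> - (p f *\<^sub>R u0)"
        using \<epsilon>(2)[of \<mu>] \<mu> by auto
      have "succOp (\<lambda>f. - rank1 u \<phi> f) (resolvent D A (of_real \<mu>))"
        unfolding i_iff[OF R(1)] using R(2) by (intro exI[of _ 1]) simp
      then show ?thesis using resolves_imp_resolvent_set[OF R(1)] by blast
    qed
    then show ?i using \<epsilon>(1) by blast
  qed
  ultimately show ?thesis by blast
qed

end
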